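(* Let $\varepsilon\in\{1,-1\}$ and consider $$iv_t+\Delta v=\varepsilon(|v|^p-1)v,\qquad (t,x)\in\mathbb{R}\times\mathbb{R}^n .$$ Breather solutions $v$ (with nonzero background $1$) of this equation cannot exist in any of the following regimes: (1) Cubic case $p=2$: (i) $n=1$ and $\varepsilon\big(E_{nz}[v]-\frac{\varepsilon}{2}M_{nz}[v]\big)\le0$; (ii) $n=2$ and $E_{nz}[v]\neq0$. (2) Quintic case $p=4$: (i) $n=1$ and $E_{nz}[v]\ne0$; (ii) $n=2$ and $\varepsilon\big(E_{nz}[v]+\varepsilon M_{nz}[v]\big)\ge0$.
   Context: The equation for $v$ arises from $iu_t+\Delta u=\varepsilon|u|^pu$ via $u(t,x)=e^{-i\varepsilon t}v(t,x)$; solutions are considered with $v(t,\cdot)\in 1+H^1(\mathbb{R}^n)$. The conserved mass and energy are $$M_{nz}[v]=\int_{\mathbb{R}^n}(|v|^2-1)\,dx,\qquad E_{nz}[v]=\int_{\mathbb{R}^n}\Big(|\nabla_xv|^2-\tfrac{2\varepsilon}{p+2}\big(1-|v|^{p+2}\big)\Big)dx .$$ Breather (with nonzero background $1$): a nontrivial ($v\not\equiv1$) solution $v:\mathbb{R}\times\mathbb{R}^n\to\mathbb{C}$ of the equation for which there exist $\tau,C,\gamma>0$ such that: (i) $v(t+\tau,x)=v(t,x)$ for all $(t,x)\in\mathbb{R}\times\mathbb{R}^n$; (ii) $v(t,\cdot)\in C^\infty(\mathbb{R}^n)\cap(1+H^1(\mathbb{R}^n))$ for all $t\in\mathbb{R}$;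 (iii) $\sup_{t\in\mathbb{R}}|D_x^\alpha(v(t,x)-1)|\le Ce^{-\gamma|x|}$ for all $x\in\mathbb{R}^n$ and all multi-indices $|\alpha|\le2$. *)

theory Defs
  imports "HOL-Analysis.Analysis"
begin

definition partial_deriv :: "'n::finite \<Rightarrow> (real^'n \<Rightarrow> 'b::real_normed_vector) \<Rightarrow> real^'n \<Rightarrow> 'b" where
  "partial_deriv i f x = vector_derivative (\<lambda>h. f (x + h *\<^sub>R axis i 1)) (at 0)"

text \<open>
  A multi-index of order k is represented by a list of k coordinate directions. All orderings
  of the directions occur as lists, so quantifying over the lists of length at most k covers all
  multi-indices of order at most k (and for smooth functions the ordering is irrelevant).
\<close>
definition iterated_partial :: "'n::finite list \<Rightarrow> (real^'n \<Rightarrow> 'b::real_normed_vector) \<Rightarrow> real^'n \<Rightarrow> 'b" where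
  "iterated_partial is f = foldr partial_deriv is f"

definition laplacian :: "(real^'n::finite \<Rightarrow> 'b::real_normed_vector) \<Rightarrow> real^'n \<Rightarrow> 'b" where
  "laplacian f x = (\<Sum>i\<in>UNIV. partial_deriv i (partial_deriv i f) x)"

text \<open>
  All iterated partial derivatives exist and are (Frechet) differentiable, hence continuous;
  this is the class of infinitely differentiable functions on the whole space.
\<close>
definition smooth :: "(real^'n::finite \<Rightarrow> 'b::real_normed_vector) \<Rightarrow> bool" where
  "smooth f \<longleftrightarrow> (\<forall>is. iterated_partial is f differentiable_on UNIV)"

definition test_function :: "(real^'n::finite \<Rightarrow> real) \<Rightarrow> bool" where
  "test_function \<phi> \<longleftrightarrow> smooth \<phi> \<and> compact (closure {x. \<phi> x \<noteq> 0})"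

definition square_integrable :: "(real^'n::finite \<Rightarrow> complex) \<Rightarrow> bool" where
  "square_integrable f \<longleftrightarrow>
     f \<in> borel_measurable lebesgue \<and> integrable lebesgue (\<lambda>x. (cmod (f x))\<^sup>2)"

definition weak_partial :: "'n::finite \<Rightarrow> (real^'n \<Rightarrow> complex) \<Rightarrow> (real^'n \<Rightarrow> complex) \<Rightarrow> bool" where
  "weak_partial i f g \<longleftrightarrow>
     (\<forall>\<phi>. test_function \<phi> \<longrightarrow>
        (LINT x|lebesgue. partial_deriv i \<phi> x *\<^sub>R f x) = - (LINT x|lebesgue. \<phi> x *\<^sub>R g x))"

definition H1 :: "(real^'n::finite \<Rightarrow> complex) set" where
  "H1 = {f. square_integrable f \<and> (\<forall>i. \<exists>g. square_integrable g \<and> weak_partial i f g)}"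

text \<open>
  Classical pointwise solution. The spatial regularity that gives the Laplacian its meaning is
  part of the notion of breather below.
\<close>
definition nls_solution :: "real \<Rightarrow> nat \<Rightarrow> (real \<Rightarrow> real^'n::finite \<Rightarrow> complex) \<Rightarrow> bool" where
  "nls_solution \<epsilon> p v \<longleftrightarrow>
     (\<forall>t x. (\<lambda>s. v s x) differentiable (at t) \<and>
        \<i> * vector_derivative (\<lambda>s. v s x) (at t) + laplacian (v t) x
          = complex_of_real (\<epsilon> * (cmod (v t x) ^ p - 1)) * v t x)"

definition M_nz :: "(real^'n::finite \<Rightarrow> complex) \<Rightarrow> real" where
  "M_nz w = (LINT x|lebesgue. (cmod (w x))\<^sup>2 - 1)"

definition E_nz :: "real \<Rightarrow> nat \<Rightarrow> (real^'n::finite \<Rightarrow> complex) \<Rightarrow> real" where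
  "E_nz \<epsilon> p w =
     (LINT x|lebesgue. (\<Sum>i\<in>UNIV. (cmod (partial_deriv i w x))\<^sup>2)
        - 2 * \<epsilon> / (real p + 2) * (1 - cmod (w x) ^ (p + 2)))"

definition breather :: "real \<Rightarrow> nat \<Rightarrow> (real \<Rightarrow> real^'n::finite \<Rightarrow> complex) \<Rightarrow> bool" where
  "breather \<epsilon> p v \<longleftrightarrow>
     nls_solution \<epsilon> p v \<and>
     (\<exists>t x. v t x \<noteq> 1) \<and>
     (\<exists>\<tau> C \<gamma>. \<tau> > 0 \<and> C > 0 \<and> \<gamma> > 0 \<and>
        (\<forall>t x. v (t + \<tau>) x = v t x) \<and>
        (\<forall>t. smooth (v t) \<and> (\<lambda>x. v t x - 1) \<in> H1) \<and>
        (\<forall>is. length is \<le> 2 \<longrightarrow>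
           (\<forall>t x. cmod (iterated_partial is (\<lambda>y. v t y - 1) x) \<le> C * exp (- \<gamma> * norm x))))"

end

(*
  For w = v - 1 all spatial derivatives up to order two decay exponentially, uniformly in time, so the
  virial functional J(t) = Im \<integral> conj(v) x . grad v dx is finite, and it is periodic. Integration by parts
  (Pohozaev) gives J' = 2 \<integral> |grad v|^2 + n eps (p / (p + 2)) \<integral> (|v|^(p+2) - 1). Mass and energy are
  conserved. If n p = 4 this is J' = 2 E, so E = 0. In the two other cases eps J' is, up to a conserved
  term of the same sign, the integral of a function of |v|^2 of one sign vanishing only at |v| = 1;
  periodicity forces J' = 0, hence |v| = 1, then grad v = 0 and v = 1.

  A breather is only assumed to be pointwise differentiable in time, with no control on the time
  derivative of grad v. Therefore J and E are not differentiated under the integral; their increments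
  are expressed through v(a+h) - v(a) by parts, with a remainder bounded by
  \<integral> |grad (v(a+h) - v(a))|^2 = o(h).
*)
theory Submission
  imports Defs
begin

subsection \<open>Uniform exponential decay\<close>

text \<open>Write m = p/2, n for the dimension and X_j for the integral of |v|^(2j) - 1. In terms of
  the energy the virial identity reads J' = 2 E + eps ((n m - 2) / (m + 1)) X_(m+1). The number n m
  - 2 separates the regimes: it is 0 for the cubic plane and the quintic line, -1 for the cubic line
  and 2 for the quintic plane, which is why the last two conditions point in opposite directions.
  With y = |v|^2 the density y^(m+1) - 1 changes sign at y = 1. Subtracting a multiple of the
  conserved X_1 removes its tangent line there, and convexity leaves a remainder that is nonnegative
  for y >= 0 and has its only zero at y = 1. The multiple of the mass in each hypothesis is the one
  that does this.

  Uniform decay of v_t is read off the equation. It dominates all difference quotients of v and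
  makes them converge in L^1; the o(h) estimate rests on this convergence, because the increments of
  the Laplacian are known only to be bounded.\<close>

lemma integrable_exp_decay:
  fixes \<gamma> :: real
  assumes "\<gamma> > 0"
  shows "integrable lborel (\<lambda>x :: 'a::euclidean_space. exp (- \<gamma> * norm x))"
proof (rule integrableI_bounded)
  show "(\<lambda>x :: 'a. exp (- \<gamma> * norm x)) \<in> borel_measurable lborel" by measurable
  let ?d = "DIM('a)"
  let ?A = "\<lambda>k. cball (0::'a) (real (Suc k))"
  \<comment> \<open>The single term with \<open>k\<close> the integer part of \<open>norm x\<close>
    already dominates. Full balls serve as well as annuli, since further terms only enlarge the
    sum.\<close>
  have shell: "ennreal (norm (exp (- \<gamma> * norm x)))
        \<le> (\<Sum>k. ennreal (exp (- \<gamma> * real k)) * indicator (?A k) x)" for x :: 'a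
  proof -
    define k where "k = nat \<lfloor>norm x\<rfloor>"
    have k: "real k \<le> norm x" "norm x \<le> real (Suc k)"
      unfolding k_def by (simp_all add: of_nat_nat) linarith
    have "ennreal (norm (exp (- \<gamma> * norm x))) \<le> ennreal (exp (- \<gamma> * real k)) * indicator (?A k) x"
      using k assms by (auto simp: ennreal_leI)
    also have "\<dots> \<le> (\<Sum>k. ennreal (exp (- \<gamma> * real k)) * indicator (?A k) x)"
      using sum_le_suminf[of "\<lambda>k. ennreal (exp (- \<gamma> * real k)) * indicator (?A k) x" "{k}"]
      by (simp del: mult_minus_left mem_cball_0 indicator_simps sum_mult_indicator)
    finally show ?thesis .
  qed
  have vol: "emeasure lborel (?A k) = ennreal (unit_ball_vol ?d * real (Suc k) ^ ?d)" for k
    by (rule emeasure_cball) simp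
  \<comment> \<open>Half of the rate absorbs the polynomial growth of the ball volumes; the other
    half leaves a geometric series.\<close>
  have summ: "summable (\<lambda>k. exp (- \<gamma> * real k) * (unit_ball_vol ?d * real (Suc k) ^ ?d))"
  proof (rule summable_comparison_test_bigo)
    show "summable (\<lambda>k. norm (exp (- \<gamma> / 2) ^ k))"
      using assms by (simp add: summable_geometric)
    have "((\<lambda>x::real. x ^ ?d / exp x) \<longlongrightarrow> 0) at_top"
      by (rule tendsto_power_div_exp_0)
    moreover have lim: "filterlim (\<lambda>k. \<gamma> / 2 * real (Suc k)) at_top sequentially"
      using assms by (intro filterlim_tendsto_pos_mult_at_top[OF tendsto_const]
        filterlim_compose[OF filterlim_real_sequentially filterlim_Suc]) simp
    ultimately have "(\<lambda>k. (\<gamma> / 2 * real (Suc k)) ^ ?d / exp (\<gamma> / 2 * real (Suc k))) \<longlonglongrightarrow> 0"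
      by (rule filterlim_compose)
    then have "(\<lambda>k. (\<gamma> / 2 * real (Suc k)) ^ ?d / exp (\<gamma> / 2 * real (Suc k))) \<in> O(\<lambda>_. 1)"
      by (intro bigoI_tendsto[where c=0]) simp_all
    \<comment> \<open>The factor \<open>exp (\<gamma>/2)\<close> compensates the shift from
      \<open>k\<close> to \<open>Suc k\<close> in the exponent.\<close>
    then have "(\<lambda>k. unit_ball_vol ?d * exp (\<gamma>/2) / (\<gamma>/2)^?d *
        ((\<gamma> / 2 * real (Suc k)) ^ ?d / exp (\<gamma> / 2 * real (Suc k))) * exp (- \<gamma> / 2) ^ k)
        \<in> O(\<lambda>k. 1 * exp (- \<gamma> / 2) ^ k)"
      by (intro landau_o.big.mult landau_o.big.cmult_in_iff[THEN iffD2])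
        (use assms unit_ball_vol_pos[of "real ?d", THEN less_imp_neq, THEN not_sym] in \<open>simp_all\<close>)
    moreover have "unit_ball_vol ?d * exp (\<gamma>/2) / (\<gamma>/2)^?d *
        ((\<gamma> / 2 * real (Suc k)) ^ ?d / exp (\<gamma> / 2 * real (Suc k))) * exp (- \<gamma> / 2) ^ k
        = exp (- \<gamma> * real k) * (unit_ball_vol ?d * real (Suc k) ^ ?d)" for k
    proof -
      have "exp (\<gamma>/2) / exp (\<gamma> / 2 * real (Suc k)) * exp (- \<gamma> / 2) ^ k = exp (- \<gamma> * real k)"
        by (simp add: exp_of_nat_mult[symmetric] exp_diff[symmetric] exp_add[symmetric] field_simps)
      moreover have "V * A / g ^ ?d * ((g * S) ^ ?d / B) * D = A / B * D * (V * S ^ ?d)"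
        if "g \<noteq> 0" for V A g S B D :: real
        using that by (simp add: power_mult_distrib)
      ultimately show ?thesis using assms by (metis half_gt_zero less_numeral_extra(3))
    qed
    ultimately show "(\<lambda>k. exp (- \<gamma> * real k) * (unit_ball_vol ?d * real (Suc k) ^ ?d))
        \<in> O(\<lambda>k. exp (- \<gamma> / 2) ^ k)" by simp
  qed
  have "(\<integral>\<^sup>+ x. ennreal (norm (exp (- \<gamma> * norm (x::'a)))) \<partial>lborel)
      \<le> (\<integral>\<^sup>+ x. (\<Sum>k. ennreal (exp (- \<gamma> * real k)) * indicator (?A k) x) \<partial>lborel)"
    by (intro nn_integral_mono shell)
  also have "\<dots> = (\<Sum>k. \<integral>\<^sup>+ x. ennreal (exp (- \<gamma> * real k)) * indicator (?A k) x \<partial>lborel)"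
    by (intro nn_integral_suminf borel_measurable_times_ennreal borel_measurable_const
        borel_measurable_indicator) simp
  also have "\<dots> = (\<Sum>k. ennreal (exp (- \<gamma> * real k) * (unit_ball_vol ?d * real (Suc k) ^ ?d)))"
    by (simp add: nn_integral_cmult_indicator vol ennreal_mult del: of_nat_Suc)
  also have "\<dots> < \<infinity>"
    unfolding infinity_ennreal_def less_top[symmetric]
    by (intro ennreal_suminf_neq_top[OF summ] mult_nonneg_nonneg) auto
  finally show "(\<integral>\<^sup>+ x. ennreal (norm (exp (- \<gamma> * norm (x::'a)))) \<partial>lborel) < \<infinity>" .
qed

text \<open>Dominated convergence for a real parameter, reduced to sequences. The bound excludes
  \<open>h = a\<close>, as suits difference quotients. The third conclusion is convergence in L^1,
  needed where the other factor of a product is only bounded.\<close>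

lemma integral_tendsto_dominated_at:
  fixes f :: "real \<Rightarrow> 'a \<Rightarrow> 'b::{banach, second_countable_topology}"
  assumes meas: "\<And>h. f h \<in> borel_measurable M"
    and lim: "\<And>x. ((\<lambda>h. f h x) \<longlongrightarrow> g x) (at a)"
    and bound: "\<And>h x. h \<noteq> a \<Longrightarrow> norm (f h x) \<le> w x"
    and w: "integrable M w"
  shows "integrable M g" and "((\<lambda>h. LINT x|M. f h x) \<longlongrightarrow> (LINT x|M. g x)) (at a)"
    and "((\<lambda>h. LINT x|M. norm (f h x - g x)) \<longlongrightarrow> 0) (at a)"
proof -
  have seq: "(\<lambda>n. f (X n) x) \<longlonglongrightarrow> g x" if "\<forall>n. X n \<noteq> a" "X \<longlonglongrightarrow> a" for X :: "nat \<Rightarrow> real" and x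
    using lim[of x] that by (auto simp: tendsto_at_iff_sequentially o_def)
  have X0: "\<forall>n. a + inverse (real (Suc n)) \<noteq> a" "(\<lambda>n. a + inverse (real (Suc n))) \<longlonglongrightarrow> a"
    using LIMSEQ_inverse_real_of_nat_add[of a] by simp_all
  have g[measurable]: "g \<in> borel_measurable M"
    by (rule borel_measurable_LIMSEQ_metric[OF meas seq[OF X0]])
  note meas[measurable]
  show gi: "integrable M g"
    using seq[OF X0] X0(1) bound
    by (intro integrable_dominated_convergence[where
        s = "\<lambda>n. f (a + inverse (real (Suc n)))", OF g meas w]) (auto intro!: AE_I2)
  have gw: "norm (g x) \<le> w x" for x
  proof (rule tendsto_upperbound)
    show "(\<lambda>n. norm (f (a + inverse (real (Suc n))) x)) \<longlonglongrightarrow> norm (g x)"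
      by (intro tendsto_norm seq X0)
    show "\<forall>\<^sub>F n in sequentially. norm (f (a + inverse (real (Suc n))) x) \<le> w x"
      using X0(1) bound by (intro always_eventually) blast
  qed simp
  show "((\<lambda>h. LINT x|M. f h x) \<longlongrightarrow> (LINT x|M. g x)) (at a)"
    unfolding tendsto_at_iff_sequentially o_def
    by (intro allI impI integral_dominated_convergence[OF g meas w])
      (use seq bound in auto)
  have "(\<lambda>n. LINT x|M. norm (f (X n) x - g x)) \<longlonglongrightarrow> (LINT x|M. 0)"
    if X: "\<forall>n. X n \<noteq> a" "X \<longlonglongrightarrow> a" for X :: "nat \<Rightarrow> real"
  proof (rule integral_dominated_convergence[where w = "\<lambda>x. 2 * w x"])
    show "AE x in M. (\<lambda>n. norm (f (X n) x - g x)) \<longlonglongrightarrow> 0"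
      using seq[OF X] by (auto intro!: tendsto_eq_intros AE_I2)
    show "AE x in M. norm (norm (f (X n) x - g x)) \<le> 2 * w x" for n
    proof (rule AE_I2)
      fix x show "norm (norm (f (X n) x - g x)) \<le> 2 * w x"
        using norm_triangle_ineq4[of "f (X n) x" "g x"] gw[of x] bound[of "X n" x] X(1) by simp
    qed
  qed (use w in auto)
  then show "((\<lambda>h. LINT x|M. norm (f h x - g x)) \<longlongrightarrow> 0) (at a)"
    unfolding tendsto_at_iff_sequentially o_def by simp
qed

text \<open>The index type is left free: it is time, the step of a difference quotient, or
  \<open>unit\<close> for a single function. Constants are hidden, so that sums and products need no
  bookkeeping of rates.\<close>

definition unif_decay :: "('t \<Rightarrow> 'a::real_normed_vector \<Rightarrow> 'b::real_normed_vector) \<Rightarrow> bool" where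
  "unif_decay F \<longleftrightarrow> (\<exists>C \<gamma>. \<gamma> > 0 \<and> (\<forall>t x. norm (F t x) \<le> C * exp (- \<gamma> * norm x)))"

definition unif_bounded :: "('t \<Rightarrow> 'a \<Rightarrow> 'b::real_normed_vector) \<Rightarrow> bool" where
  "unif_bounded F \<longleftrightarrow> (\<exists>C. \<forall>t x. norm (F t x) \<le> C)"

lemma unif_decayE:
  fixes F :: "'t \<Rightarrow> 'a::real_normed_vector \<Rightarrow> 'b::real_normed_vector"
  assumes "unif_decay F"
  obtains C \<gamma> where "C \<ge> 0" "\<gamma> > 0" "\<And>t x. norm (F t x) \<le> C * exp (- \<gamma> * norm x)"
proof -
  obtain C \<gamma> where *: "\<gamma> > 0" "\<And>t x. norm (F t x) \<le> C * exp (- \<gamma> * norm x)"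
    using assms unfolding unif_decay_def by blast
  \<comment> \<open>At the origin the exponential is 1, so any index shows that the constant is
    nonnegative.\<close>
  have "norm (F undefined 0) \<le> C" using *(2)[of undefined 0] by simp
  then have "C \<ge> 0" using norm_ge_zero order_trans by blast
  with * show ?thesis using that by blast
qed

lemma unif_decay_mono:
  assumes "unif_decay F" "\<And>t x. norm (G t x) \<le> C * norm (F t x)" "C \<ge> 0"
  shows "unif_decay G"
proof -
  obtain D \<gamma> where "D \<ge> 0" and *: "\<gamma> > 0" "\<And>t x. norm (F t x) \<le> D * exp (- \<gamma> * norm x)"
    using unif_decayE[OF assms(1)] by blast
  have "norm (G t x) \<le> (C * D) * exp (- \<gamma> * norm x)" for t x
    using mult_left_mono[OF *(2)[of t x] assms(3)] assms(2)[of t x] by (simp add: mult.assoc)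
  with *(1) show ?thesis unfolding unif_decay_def by blast
qed

lemma unif_decay_reindex: "unif_decay F \<Longrightarrow> unif_decay (\<lambda>s. F (g s))"
  unfolding unif_decay_def by blast

lemma unif_bounded_reindex: "unif_bounded F \<Longrightarrow> unif_bounded (\<lambda>s. F (g s))"
  unfolding unif_bounded_def by blast

lemma unif_decay_imp_bounded: "unif_decay F \<Longrightarrow> unif_bounded F"
proof (erule unif_decayE)
  fix C \<gamma> assume "C \<ge> 0" "\<gamma> > 0" and b: "\<And>t x. norm (F t x) \<le> C * exp (- \<gamma> * norm x)"
  then have "C * exp (- \<gamma> * norm x) \<le> C" for x :: 'b
    by (intro mult_left_le) auto
  then show "unif_bounded F" unfolding unif_bounded_def using b order_trans by blast
qed

lemma unif_decay_add [intro]: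
  fixes F G :: "'t \<Rightarrow> 'a::real_normed_vector \<Rightarrow> 'b::real_normed_vector"
  assumes "unif_decay F" "unif_decay G"
  shows "unif_decay (\<lambda>t x. F t x + G t x)"
proof -
  obtain C c where 1: "C \<ge> 0" "c > 0" "\<And>t x. norm (F t x) \<le> C * exp (- c * norm x)"
    using unif_decayE[OF assms(1)] by blast
  obtain D d where 2: "D \<ge> 0" "d > 0" "\<And>t x. norm (G t x) \<le> D * exp (- d * norm x)"
    using unif_decayE[OF assms(2)] by blast
  have "norm (F t x + G t x) \<le> (C + D) * exp (- min c d * norm x)" for t x
  proof -
    have "C * exp (- c * norm x) \<le> C * exp (- min c d * norm x)"
         "D * exp (- d * norm x) \<le> D * exp (- min c d * norm x)"
      using 1(1) 2(1) by (auto intro!: mult_left_mono mult_right_mono)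
    then show ?thesis
      using norm_triangle_ineq[of "F t x" "G t x"] 1(3)[of t x] 2(3)[of t x]
      by (simp add: algebra_simps)
  qed
  moreover have "min c d > 0" using 1(2) 2(2) by simp
  ultimately show ?thesis unfolding unif_decay_def by blast
qed

lemma unif_decay_uminus [intro]: "unif_decay F \<Longrightarrow> unif_decay (\<lambda>t x. - F t x)"
  by (erule unif_decay_mono[where C = 1]) simp_all

lemma unif_decay_diff [intro]: "unif_decay F \<Longrightarrow> unif_decay G \<Longrightarrow> unif_decay (\<lambda>t x. F t x - G t x)"
  using unif_decay_add[of F "\<lambda>t x. - G t x"] by auto

lemma unif_decay_0 [intro]: "unif_decay (\<lambda>t x. 0)"
  unfolding unif_decay_def by (intro exI[of _ 0] exI[of _ 1]) simp

lemma unif_decay_sum [intro]: "(\<And>i. i \<in> I \<Longrightarrow> unif_decay (F i)) \<Longrightarrow> unif_decay (\<lambda>t x. \<Sum>i\<in>I. F i t x)"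
  by (induction I rule: infinite_finite_induct) auto

lemma unif_decay_bilinear:
  assumes "bounded_bilinear b" "unif_decay F" "unif_bounded G"
  shows "unif_decay (\<lambda>t x. b (F t x) (G t x))"
proof -
  obtain K where K: "K > 0" "\<And>x y. norm (b x y) \<le> norm x * norm y * K"
    using bounded_bilinear.pos_bounded[OF assms(1)] by blast
  obtain C where C: "\<And>t x. norm (G t x) \<le> C" using assms(3) unfolding unif_bounded_def by blast
  then have "C \<ge> 0" using norm_ge_zero order_trans by blast
  have "norm (b (F t x) (G t x)) \<le> (K * C) * norm (F t x)" for t x
    by (rule order_trans[OF K(2)])
      (use mult_left_mono[OF C[of t x], of "norm (F t x) * K"] K(1) in \<open>simp add: mult_ac\<close>)
  then show ?thesis
    using K(1) \<open>C \<ge> 0\<close> by (intro unif_decay_mono[OF assms(2), where C = "K * C"]) simp_all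
qed

lemma unif_decay_inner [intro]:
  fixes F G :: "'t \<Rightarrow> 'a::real_normed_vector \<Rightarrow> 'b::real_inner"
  assumes "unif_decay F" "unif_bounded G"
  shows "unif_decay (\<lambda>t x. F t x \<bullet> G t x)" "unif_decay (\<lambda>t x. G t x \<bullet> F t x)"
  using unif_decay_bilinear[OF bounded_bilinear_inner assms] by (simp_all add: inner_commute)

lemma unif_decay_mult [intro]:
  fixes F G :: "'t \<Rightarrow> 'a::real_normed_vector \<Rightarrow> 'b::real_normed_field"
  assumes "unif_decay F" "unif_bounded G"
  shows "unif_decay (\<lambda>t x. F t x * G t x)" "unif_decay (\<lambda>t x. G t x * F t x)"
  using unif_decay_bilinear[OF bounded_bilinear_mult assms] by (simp_all add: mult.commute)

lemma unif_decay_cmult [intro]: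
  fixes F :: "'t \<Rightarrow> 'a::real_normed_vector \<Rightarrow> 'b::real_normed_field"
  shows "unif_decay F \<Longrightarrow> unif_decay (\<lambda>t x. c * F t x)"
  by (erule unif_decay_mono[where C = "norm c"]) (simp_all add: norm_mult)

lemma unif_decay_scaleR: "unif_decay F \<Longrightarrow> unif_decay (\<lambda>t x. c *\<^sub>R F t x)"
  by (erule unif_decay_mono[where C = "\<bar>c\<bar>"]) simp_all

text \<open>A linear weight costs half of the rate, because
  \<open>c / 2 * norm x \<le> exp (c / 2 * norm x)\<close>.\<close>

lemma unif_decay_component_scaleR:
  fixes F :: "'t \<Rightarrow> real^'n \<Rightarrow> 'b::real_normed_vector"
  assumes "unif_decay F"
  shows "unif_decay (\<lambda>t x. x $ k *\<^sub>R F t x)"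
proof -
  obtain C c where 1: "C \<ge> 0" "c > 0" "\<And>t x. norm (F t x) \<le> C * exp (- c * norm x)"
    using unif_decayE[OF assms] by blast
  have "norm (x $ k *\<^sub>R F t x) \<le> (C * (2 / c)) * exp (- (c / 2) * norm x)" for t x
  proof -
    have "c / 2 * norm x \<le> exp (c / 2 * norm x)"
      using exp_ge_add_one_self[of "c / 2 * norm x"] by linarith
    then have "norm x \<le> 2 / c * exp (c / 2 * norm x)"
      using 1(2) by (simp add: field_simps)
    then have "norm x * exp (- c * norm x) \<le> 2 / c * exp (c / 2 * norm x) * exp (- c * norm x)"
      by (intro mult_right_mono) simp_all
    also have "\<dots> = 2 / c * exp (- (c / 2) * norm x)"
      by (simp add: mult.assoc exp_add[symmetric])
    finally have e: "norm x * exp (- c * norm x) \<le> 2 / c * exp (- (c / 2) * norm x)" .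
    have "norm (x $ k *\<^sub>R F t x) \<le> norm x * (C * exp (- c * norm x))"
      using 1(3)[of t x] component_le_norm_cart[of x k] by (auto intro!: mult_mono)
    also have "\<dots> = C * (norm x * exp (- c * norm x))" by simp
    also have "\<dots> \<le> C * (2 / c * exp (- (c / 2) * norm x))" by (intro mult_left_mono e 1)
    finally show ?thesis by (simp add: mult.assoc)
  qed
  moreover have "c / 2 > 0" using 1(2) by simp
  ultimately show ?thesis unfolding unif_decay_def by blast
qed

lemma unif_decay_component_mult:
  fixes F :: "'t \<Rightarrow> real^'n \<Rightarrow> real"
  shows "unif_decay F \<Longrightarrow> unif_decay (\<lambda>t x. x $ k * F t x)"
  using unif_decay_component_scaleR[of F k] by simp

lemma integrable_unif_decay:
  fixes F :: "'t \<Rightarrow> 'a::euclidean_space \<Rightarrow> 'b::{banach, second_countable_topology}"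
  assumes "unif_decay F" "F t \<in> borel_measurable borel"
  shows "integrable lborel (F t)"
proof -
  obtain C c where 1: "C \<ge> 0" "c > 0" "\<And>t x. norm (F t x) \<le> C * exp (- c * norm x)"
    using unif_decayE[OF assms(1)] by blast
  show ?thesis
  proof (rule Bochner_Integration.integrable_bound)
    show "integrable lborel (\<lambda>x::'a. C * exp (- c * norm x))"
      by (intro integrable_mult_right integrable_exp_decay 1)
    show "F t \<in> borel_measurable lborel" using assms(2) by simp
    show "AE x in lborel. norm (F t x) \<le> norm (C * exp (- c * norm x))"
      using 1(1) 1(3)[of t] by (intro AE_I2) (simp add: abs_mult)
  qed
qed

lemma unif_decay_integral_bound:
  fixes F :: "'t \<Rightarrow> 'a::euclidean_space \<Rightarrow> 'b::{banach, second_countable_topology}"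
  assumes "unif_decay F"
  obtains B where "\<And>t. F t \<in> borel_measurable borel \<Longrightarrow> norm (LINT x|lborel. F t x) \<le> B"
proof -
  obtain C c where 1: "C \<ge> 0" "c > 0" "\<And>t x. norm (F t x) \<le> C * exp (- c * norm x)"
    using unif_decayE[OF assms(1)] by blast
  have "norm (LINT x|lborel. F t x) \<le> (LINT x::'a|lborel. C * exp (- c * norm x))"
    if "F t \<in> borel_measurable borel" for t
    by (rule order_trans[OF integral_norm_bound integral_mono])

      (use 1 integrable_unif_decay[OF assms that] integrable_exp_decay[OF 1(2), where 'a='a] in simp_all)
  then show ?thesis by (rule that)
qed

subsection \<open>Partial derivatives and integration by parts\<close>

text \<open>Unlike the total function \<open>partial_deriv\<close>, this relation includes
  existence, and it names the derivative so that the calculus rules can be chained.\<close>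

definition has_partial :: "'n::finite \<Rightarrow> (real^'n \<Rightarrow> 'b::real_normed_vector) \<Rightarrow> (real^'n \<Rightarrow> 'b) \<Rightarrow> bool" where
  "has_partial i f f' \<longleftrightarrow> (\<forall>x. ((\<lambda>h. f (x + h *\<^sub>R axis i 1)) has_vector_derivative f' x) (at 0))"

lemma has_partial_line:
  assumes "has_partial i f f'"
  shows "((\<lambda>h. f (x + h *\<^sub>R axis i 1)) has_vector_derivative f' (x + s *\<^sub>R axis i 1)) (at s)"
proof -
  let ?g = "\<lambda>h. f (x + s *\<^sub>R axis i 1 + h *\<^sub>R axis i 1)"
  have "(?g has_vector_derivative f' (x + s *\<^sub>R axis i 1)) (at (s - s))"
    using assms unfolding has_partial_def by simp
  then have "((?g \<circ> (\<lambda>h. h - s)) has_vector_derivative 1 *\<^sub>R f' (x + s *\<^sub>R axis i 1)) (at s)"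
    by (intro vector_diff_chain_at) (auto intro!: derivative_eq_intros)
  then show ?thesis by (simp add: o_def algebra_simps)
qed

lemma has_partial_diff:
  "has_partial i f f' \<Longrightarrow> has_partial i g g' \<Longrightarrow> has_partial i (\<lambda>x. f x - g x) (\<lambda>x. f' x - g' x)"
  unfolding has_partial_def by (auto intro!: derivative_intros)

lemma has_partial_bounded_linear:
  "bounded_linear l \<Longrightarrow> has_partial i f f' \<Longrightarrow> has_partial i (\<lambda>x. l (f x)) (\<lambda>x. l (f' x))"
  unfolding has_partial_def by (auto intro: bounded_linear.has_vector_derivative)

lemma has_partial_inner:
  "has_partial i f f' \<Longrightarrow> has_partial i g g' \<Longrightarrow>
    has_partial i (\<lambda>x. f x \<bullet> g x) (\<lambda>x. f x \<bullet> g' x + f' x \<bullet> g x)"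
  unfolding has_partial_def
proof (intro allI)
  fix x
  assume f: "\<forall>x. ((\<lambda>h. f (x + h *\<^sub>R axis i 1)) has_vector_derivative f' x) (at 0)"
    and g: "\<forall>x. ((\<lambda>h. g (x + h *\<^sub>R axis i 1)) has_vector_derivative g' x) (at 0)"
  show "((\<lambda>h. f (x + h *\<^sub>R axis i 1) \<bullet> g (x + h *\<^sub>R axis i 1)) has_vector_derivative
      f x \<bullet> g' x + f' x \<bullet> g x) (at 0)"
    using bounded_bilinear.has_vector_derivative[OF bounded_bilinear_inner f[rule_format, of x] g[rule_format, of x]]
    by simp
qed

lemma has_partial_component_mult:
  fixes f :: "real^'n::finite \<Rightarrow> real"
  assumes "has_partial i f f'"
  shows "has_partial i (\<lambda>x. x $ k * f x) (\<lambda>x. (if i = k then f x else 0) + x $ k * f' x)"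
  unfolding has_partial_def
proof
  fix x :: "real^'n"
  have 1: "((\<lambda>h. f (x + h *\<^sub>R axis i 1)) has_vector_derivative f' x) (at 0)"
    using assms unfolding has_partial_def by blast
  have 2: "((\<lambda>h. (x + h *\<^sub>R axis i 1) $ k) has_vector_derivative (if i = k then 1 else 0)) (at 0)"
    by (auto simp: axis_def intro!: derivative_eq_intros)
  show "((\<lambda>h. (x + h *\<^sub>R axis i 1) $ k * f (x + h *\<^sub>R axis i 1)) has_vector_derivative
      (if i = k then f x else 0) + x $ k * f' x) (at 0)"
    using bounded_bilinear.has_vector_derivative[OF bounded_bilinear_mult 2 1] by (auto simp: algebra_simps)
qed

lemma has_partial_compose_real:
  fixes f :: "real^'n::finite \<Rightarrow> real"
  assumes "has_partial i f f'" "\<And>y. (g has_real_derivative g' y) (at y)"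
  shows "has_partial i (\<lambda>x. g (f x)) (\<lambda>x. g' (f x) * f' x)"
  unfolding has_partial_def
proof
  fix x :: "real^'n"
  have "((\<lambda>h. f (x + h *\<^sub>R axis i 1)) has_real_derivative f' x) (at 0)"
    using assms unfolding has_partial_def has_real_derivative_iff_has_vector_derivative by blast
  from DERIV_chain2[OF assms(2) this]
  show "((\<lambda>h. g (f (x + h *\<^sub>R axis i 1))) has_vector_derivative g' (f x) * f' x) (at 0)"
    unfolding has_real_derivative_iff_has_vector_derivative by simp
qed

section \<open>Translation invariance and integration by parts on the whole space\<close>

lemma integral_lborel_translation:
  fixes f :: "'a::euclidean_space \<Rightarrow> 'b::{banach, second_countable_topology}"
  assumes "integrable lborel f"
  shows "integrable lborel (\<lambda>x. f (x + c))" "(LINT x|lborel. f (x + c)) = (LINT x|lborel. f x)"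
proof -
  have f: "f \<in> borel_measurable borel" using borel_measurable_integrable[OF assms] by simp
  have d: "distr lborel borel ((+) c) = lborel" by (rule lborel_distr_plus)
  have "integrable (distr lborel borel ((+) c)) f" using assms d by simp
  then show "integrable lborel (\<lambda>x. f (x + c))"
    by (subst (asm) integrable_distr_eq) (use f in \<open>simp_all add: add.commute\<close>)
  have "(LINT x|distr lborel borel ((+) c). f x) = (LINT x|lborel. f (c + x))"
    by (rule integral_distr) (use f in simp_all)
  then show "(LINT x|lborel. f (x + c)) = (LINT x|lborel. f x)" by (simp add: d add.commute)
qed

text \<open>The difference quotients of \<open>F t\<close> have integral zero by translation invariance and are
  dominated, so no iterated integral is needed.\<close>

lemma integral_partial_eq_0:
  fixes F F' :: "'t \<Rightarrow> real^'n::finite \<Rightarrow> real"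
  assumes part: "has_partial i (F t) (F' t)" and decay: "unif_decay F" "unif_decay F'"
    and meas: "F t \<in> borel_measurable borel"
  shows "(LINT x|lborel. F' t x) = 0"
proof -
  obtain C c where C: "C \<ge> 0" "c > 0" "\<And>t x. norm (F' t x) \<le> C * exp (- c * norm x)"
    using unif_decayE[OF decay(2)] by blast
  define h where "h n = inverse (real (Suc n))" for n
  have h: "h n > 0" "h n \<le> 1" "h n \<noteq> 0" for n
    unfolding h_def by (auto simp: field_simps)
  have hlim: "h \<longlonglongrightarrow> 0" unfolding h_def by (rule LIMSEQ_inverse_real_of_nat)
  define q where "q n x = (F t (x + h n *\<^sub>R axis i 1) - F t x) / h n" for n x
  note meas[measurable]
  have int: "integrable lborel (F t)" by (rule integrable_unif_decay[OF decay(1) meas])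
  have q0: "(LINT x|lborel. q n x) = 0" for n
    unfolding q_def using integral_lborel_translation[OF int, of "h n *\<^sub>R axis i 1"] int by simp
  have qlim: "(\<lambda>n. q n x) \<longlonglongrightarrow> F' t x" for x
  proof -
    have "((\<lambda>s. (F t (x + s *\<^sub>R axis i 1) - F t x) / s) \<longlongrightarrow> F' t x) (at 0)"
      using part unfolding has_partial_def has_real_derivative_iff_has_vector_derivative[symmetric]
      by (auto simp: DERIV_def)
    then show ?thesis
      unfolding q_def tendsto_at_iff_sequentially o_def using h(3) hlim by auto
  qed
  \<comment> \<open>By the mean value theorem the quotient is a value of \<open>F'\<close> at a
    point at distance less than 1 from \<open>x\<close>, since \<open>h n \<le> 1\<close>. Moving
    the bound back to \<open>x\<close> costs the factor \<open>exp c\<close>.\<close>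
  have qbound: "norm (q n x) \<le> C * exp c * exp (- c * norm x)" for n x
  proof -
    have "\<exists>z. 0 < z \<and> z < h n \<and> F t (x + h n *\<^sub>R axis i 1) - F t (x + 0 *\<^sub>R axis i 1)
        = (h n - 0) * F' t (x + z *\<^sub>R axis i 1)"
      by (rule MVT2[OF h(1)])
        (use has_partial_line[OF part] in \<open>simp add: has_real_derivative_iff_has_vector_derivative\<close>)
    then obtain z where z: "0 < z" "z < h n"
      "F t (x + h n *\<^sub>R axis i 1) - F t x = h n * F' t (x + z *\<^sub>R axis i 1)" by auto
    then have "norm (q n x) = norm (F' t (x + z *\<^sub>R axis i 1))" using h(3) by (simp add: q_def)
    also have "\<dots> \<le> C * exp (- c * norm (x + z *\<^sub>R axis i 1))" by (rule C)
    also have "\<dots> \<le> C * exp (c + - c * norm x)"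
    proof -
      have "norm (z *\<^sub>R axis i (1::real)) \<le> 1" using z h(2)[of n] by (simp add: norm_axis_1)
      then have "norm x \<le> norm (x + z *\<^sub>R axis i 1) + 1"
        using norm_triangle_ineq4[of "x + z *\<^sub>R axis i 1" "z *\<^sub>R axis i 1"] by simp
      then have "c * norm x \<le> c * (norm (x + z *\<^sub>R axis i 1) + 1)" using C(2) by simp
      then show ?thesis using C(1) by (intro mult_left_mono) (simp_all add: algebra_simps)
    qed
    finally show ?thesis by (simp add: exp_diff exp_minus field_simps)
  qed
  have "F' t \<in> borel_measurable lborel"
    by (rule borel_measurable_LIMSEQ_metric[OF _ qlim]) (simp add: q_def)
  then have "(\<lambda>n. LINT x|lborel. q n x) \<longlonglongrightarrow> (LINT x|lborel. F' t x)"
    by (rule integral_dominated_convergence[where w = "\<lambda>x. C * exp c * exp (- c * norm x)"])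

      (use qlim qbound integrable_exp_decay[OF C(2), where 'a = "real^'n"] in \<open>auto simp: q_def\<close>)
  then show ?thesis using q0 by (simp add: LIMSEQ_const_iff)
qed

text \<open>Decay is asked of the products, so that one factor may be merely bounded, like
  \<open>v\<close>, which tends to 1 at infinity.\<close>

lemma integral_parts:
  fixes F G F' G' :: "'t \<Rightarrow> real^'n::finite \<Rightarrow> 'b::euclidean_space"
  assumes part: "has_partial i (F t) (F' t)" "has_partial i (G t) (G' t)"
    and cont: "continuous_on UNIV (F t)" "continuous_on UNIV (G t)"
      "continuous_on UNIV (F' t)" "continuous_on UNIV (G' t)"
    and decay: "unif_decay (\<lambda>t x. F t x \<bullet> G t x)" "unif_decay (\<lambda>t x. F t x \<bullet> G' t x)"
      "unif_decay (\<lambda>t x. F' t x \<bullet> G t x)"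
  shows "(LINT x|lborel. F t x \<bullet> G' t x) = - (LINT x|lborel. F' t x \<bullet> G t x)"
proof -
  have [measurable]: "F t \<in> borel_measurable borel" "G t \<in> borel_measurable borel"
      "F' t \<in> borel_measurable borel" "G' t \<in> borel_measurable borel"
    using cont by (auto intro: borel_measurable_continuous_onI)
  have "(LINT x|lborel. F t x \<bullet> G' t x + F' t x \<bullet> G t x) = 0"
    using has_partial_inner[OF part] unif_decay_add[OF decay(2,3)]
    by (intro integral_partial_eq_0[where F = "\<lambda>t x. F t x \<bullet> G t x" and t = t and
        F' = "\<lambda>t x. F t x \<bullet> G' t x + F' t x \<bullet> G t x"] decay) auto
  moreover have "integrable lborel (\<lambda>x. F t x \<bullet> G' t x)" "integrable lborel (\<lambda>x. F' t x \<bullet> G t x)"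
    by (rule integrable_unif_decay[OF decay(2), of t] integrable_unif_decay[OF decay(3), of t]; simp)+
  ultimately show ?thesis by simp
qed

section \<open>Symmetry of second partial derivatives\<close>

lemma second_difference_mvt:
  fixes f :: "real^'n::finite \<Rightarrow> real"
  assumes "has_partial i f fi" "has_partial j fi fij" "h > 0"
  obtains s r where "0 < s" "s < h" "0 < r" "r < h"
    "f (x + h *\<^sub>R axis i 1 + h *\<^sub>R axis j 1) - f (x + h *\<^sub>R axis i 1) - f (x + h *\<^sub>R axis j 1) + f x
      = h\<^sup>2 * fij (x + s *\<^sub>R axis i 1 + r *\<^sub>R axis j 1)"
proof -
  let ?g = "\<lambda>s. f (x + h *\<^sub>R axis j 1 + s *\<^sub>R axis i 1) - f (x + s *\<^sub>R axis i 1)"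
  let ?g' = "\<lambda>s. fi (x + h *\<^sub>R axis j 1 + s *\<^sub>R axis i 1) - fi (x + s *\<^sub>R axis i 1)"
  have "\<exists>s. 0 < s \<and> s < h \<and> ?g h - ?g 0 = (h - 0) * ?g' s"
    by (rule MVT2[OF assms(3)]) (unfold has_real_derivative_iff_has_vector_derivative,
      intro has_vector_derivative_diff has_partial_line[OF assms(1)])
  then obtain s where s: "0 < s" "s < h" "?g h - ?g 0 = h * ?g' s" by auto
  let ?y = "x + s *\<^sub>R axis i 1"
  have "\<exists>r. 0 < r \<and> r < h \<and> fi (?y + h *\<^sub>R axis j 1) - fi (?y + 0 *\<^sub>R axis j 1) =
      (h - 0) * fij (?y + r *\<^sub>R axis j 1)"
    by (rule MVT2[OF assms(3)]) (unfold has_real_derivative_iff_has_vector_derivative,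
      intro has_partial_line[OF assms(2)])
  then obtain r where r: "0 < r" "r < h" "fi (?y + h *\<^sub>R axis j 1) - fi ?y = h * fij (?y + r *\<^sub>R axis j 1)"
    by auto
  show ?thesis
  proof (rule that[OF s(1,2) r(1,2)])
    have "?g' s = h * fij (?y + r *\<^sub>R axis j 1)" using r(3) by (simp add: add_ac)
    then have "?g h - ?g 0 = h * (h * fij (?y + r *\<^sub>R axis j 1))" using s(3) by simp
    then show "f (x + h *\<^sub>R axis i 1 + h *\<^sub>R axis j 1) - f (x + h *\<^sub>R axis i 1)
        - f (x + h *\<^sub>R axis j 1) + f x = h\<^sup>2 * fij (?y + r *\<^sub>R axis j 1)"
      by (simp add: power2_eq_square add_ac)
  qed
qed

lemma second_difference_tendsto:
  fixes f :: "real^'n::finite \<Rightarrow> real"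
  assumes "has_partial i f fi" "has_partial j fi fij" "isCont fij x"
  shows "((\<lambda>h. (f (x + h *\<^sub>R axis i 1 + h *\<^sub>R axis j 1) - f (x + h *\<^sub>R axis i 1)
      - f (x + h *\<^sub>R axis j 1) + f x) / h\<^sup>2) \<longlongrightarrow> fij x) (at_right 0)"
proof (rule tendstoI)
  fix e :: real assume "e > 0"
  then obtain d where d: "d > 0" "\<And>y. dist y x < d \<Longrightarrow> dist (fij y) (fij x) < e"
    using assms(3) unfolding continuous_at_eps_delta by blast
  have "\<forall>\<^sub>F h in at_right 0. 0 < h \<and> h < d / 2"
    using eventually_at_right_real[of 0 "d / 2"] d(1) by simp
  then show "\<forall>\<^sub>F h in at_right 0. dist ((f (x + h *\<^sub>R axis i 1 + h *\<^sub>R axis j 1) - f (x + h *\<^sub>R axis i 1)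
      - f (x + h *\<^sub>R axis j 1) + f x) / h\<^sup>2) (fij x) < e"
  proof eventually_elim
    case (elim h)
    obtain s r where sr: "0 < s" "s < h" "0 < r" "r < h" and
      eq: "f (x + h *\<^sub>R axis i 1 + h *\<^sub>R axis j 1) - f (x + h *\<^sub>R axis i 1) - f (x + h *\<^sub>R axis j 1) + f x
      = h\<^sup>2 * fij (x + s *\<^sub>R axis i 1 + r *\<^sub>R axis j 1)"
      using second_difference_mvt[OF assms(1,2), of h x] elim by metis
    have "dist (x + s *\<^sub>R axis i 1 + r *\<^sub>R axis j 1) x = norm (s *\<^sub>R axis i (1::real) + r *\<^sub>R axis j 1)"
      by (simp add: dist_norm add.assoc)
    also have "\<dots> \<le> s + r"
      using norm_triangle_ineq[of "s *\<^sub>R axis i (1::real)" "r *\<^sub>R axis j 1"] sr by (simp add: norm_axis_1)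
    also have "\<dots> < d" using sr elim by simp
    finally have "dist (fij (x + s *\<^sub>R axis i 1 + r *\<^sub>R axis j 1)) (fij x) < e" by (rule d(2))
    then show ?case using elim by (simp add: eq)
  qed
qed

text \<open>The second difference quotient is symmetric in \<open>i\<close> and \<open>j\<close> and
  tends to both mixed derivatives. Pairing with a vector \<open>w\<close> reduces to real values,
  where the mean value theorem holds.\<close>

lemma has_partial_commute:
  fixes f :: "real^'n::finite \<Rightarrow> 'b::real_inner"
  assumes "has_partial i f fi" "has_partial j fi fij" "has_partial j f fj" "has_partial i fj fji"
    "isCont fij x" "isCont fji x"
  shows "fij x = fji x"
proof -
  have "fij x \<bullet> w = fji x \<bullet> w" for w
  proof -
    have l: "has_partial k (\<lambda>x. g x \<bullet> w) (\<lambda>x. g' x \<bullet> w)" if "has_partial k g g'" for k g g'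
      by (rule has_partial_bounded_linear[OF bounded_linear_inner_left that])
    have "isCont (\<lambda>x. fij x \<bullet> w) x" "isCont (\<lambda>x. fji x \<bullet> w) x"
      using assms(5,6) by (auto intro: continuous_intros)
    from second_difference_tendsto[OF l[OF assms(1)] l[OF assms(2)] this(1)]
      second_difference_tendsto[OF l[OF assms(3)] l[OF assms(4)] this(2)]
    show ?thesis
      by (intro tendsto_unique[OF trivial_limit_at_right_real]) (simp_all add: algebra_simps)
  qed
  then show ?thesis by (metis vector_eq_rdot)
qed

text \<open>The mean value inequality turns the decay of \<open>F'\<close>, uniform in time, into
  one dominating function for all difference quotients. It serves for functionals of
  \<open>v\<close> without its gradient.\<close>

lemma has_real_derivative_integral:
  fixes F F' :: "real \<Rightarrow> 'a::euclidean_space \<Rightarrow> real"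
  assumes deriv: "\<And>t x. ((\<lambda>s. F s x) has_real_derivative F' t x) (at t)"
    and decay: "unif_decay F" "unif_decay F'"
    and meas: "\<And>t. F t \<in> borel_measurable borel"
  shows "((\<lambda>t. LINT x|lborel. F t x) has_real_derivative (LINT x|lborel. F' t x)) (at t)"
proof -
  obtain C c where C: "C \<ge> 0" "c > 0" "\<And>t x. norm (F' t x) \<le> C * exp (- c * norm x)"
    using unif_decayE[OF decay(2)] by blast
  have int: "integrable lborel (F t)" for t by (rule integrable_unif_decay[OF decay(1) meas])
  note meas[measurable]
  have "((\<lambda>h. LINT x|lborel. (F (t + h) x - F t x) / h) \<longlongrightarrow> (LINT x|lborel. F' t x)) (at 0)"
  proof (rule integral_tendsto_dominated_at(2))
    show "((\<lambda>h. (F (t + h) x - F t x) / h) \<longlongrightarrow> F' t x) (at 0)" for x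
      using deriv[of x t] by (simp add: DERIV_def)
    show "norm ((F (t + h) x - F t x) / h) \<le> C * exp (- c * norm x)" if "h \<noteq> 0" for h x
    proof -
      have "norm (F (t + h) x - F t x) \<le> C * exp (- c * norm x) * norm (t + h - t)"
        by (rule field_differentiable_bound[where S = UNIV and f' = "\<lambda>s. F' s x"])
          (use deriv C in \<open>auto intro: has_field_derivative_at_within\<close>)
      then show ?thesis using that by (simp add: field_simps)
    qed
    show "(\<lambda>x. (F (t + h) x - F t x) / h) \<in> borel_measurable lborel" for h by simp
    show "integrable lborel (\<lambda>x::'a. C * exp (- c * norm x))"
      by (intro integrable_mult_right integrable_exp_decay C)
  qed
  then show ?thesis by (simp add: DERIV_def int)
qed

subsection \<open>The flow in abstract form\<close>

lemma inner_ii_complex [simp]: "(\<i> * a) \<bullet> (a::complex) = 0" "a \<bullet> (\<i> * a) = 0"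
  by (simp_all add: inner_complex_def)

lemma inner_ii_left: "(\<i> * a) \<bullet> (b::complex) = - (a \<bullet> (\<i> * b))"
  by (simp add: inner_complex_def)

lemma integrable_unif_decay_continuous:
  fixes F :: "'t \<Rightarrow> 'a::euclidean_space \<Rightarrow> 'b::{banach, second_countable_topology}"
  assumes "unif_decay F" "continuous_on UNIV (F t)"
  shows "integrable lborel (F t)"
  using assms by (intro integrable_unif_decay borel_measurable_continuous_onI)

lemma unif_bounded_const: "unif_bounded (\<lambda>t x. c)"
  unfolding unif_bounded_def by blast

lemma unif_bounded_add:
  fixes F G :: "'t \<Rightarrow> 'a \<Rightarrow> 'b::real_normed_vector"
  assumes "unif_bounded F" "unif_bounded G"
  shows "unif_bounded (\<lambda>t x. F t x + G t x)"
proof -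
  obtain C D where "\<And>t x. norm (F t x) \<le> C" "\<And>t x. norm (G t x) \<le> D"
    using assms unfolding unif_bounded_def by blast
  then have "norm (F t x + G t x) \<le> C + D" for t x
    using norm_triangle_mono by blast
  then show ?thesis unfolding unif_bounded_def by blast
qed

lemma unif_bounded_cmult:
  fixes F :: "'t \<Rightarrow> 'a \<Rightarrow> 'b::real_normed_field"
  shows "unif_bounded F \<Longrightarrow> unif_bounded (\<lambda>t x. c * F t x)"
  unfolding unif_bounded_def norm_mult by (meson mult_left_mono norm_ge_zero)

lemma unif_bounded_scaleR: "unif_bounded F \<Longrightarrow> unif_bounded (\<lambda>t x. c *\<^sub>R F t x)"
  unfolding unif_bounded_def norm_scaleR by (meson mult_left_mono abs_ge_zero)

text \<open>The exponent is \<open>2 * m\<close>, which makes the nonlinearity a polynomial in |v|^2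
  times \<open>v\<close>. About \<open>V\<close> only pointwise existence is assumed; its continuity
  and decay follow from the equation.\<close>

locale nls_flow =
  fixes v V :: "real \<Rightarrow> real^'n::finite \<Rightarrow> complex"
    and d :: "'n \<Rightarrow> real \<Rightarrow> real^'n \<Rightarrow> complex"
    and dd :: "'n \<Rightarrow> 'n \<Rightarrow> real \<Rightarrow> real^'n \<Rightarrow> complex"
    and \<epsilon> :: real and m :: nat
  assumes partial: "has_partial k (v t) (d k t)"
    and partial2: "has_partial j (d k t) (dd j k t)"
    and cont_v: "continuous_on UNIV (v t)"
    and cont_d: "continuous_on UNIV (d k t)"
    and cont_dd: "continuous_on UNIV (dd j k t)"
    and time_deriv: "((\<lambda>s. v s x) has_vector_derivative V t x) (at t)"
    and nls: "\<i> * V t x + (\<Sum>k\<in>UNIV. dd k k t x)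
      = complex_of_real (\<epsilon> * (cmod (v t x) ^ (2 * m) - 1)) * v t x"
    and decay_v: "unif_decay (\<lambda>t x. v t x - 1)"
    and decay_d: "unif_decay (d k)"
    and decay_dd: "unif_decay (dd j k)"
begin

definition L :: "real \<Rightarrow> real^'n \<Rightarrow> complex" where "L t x = (\<Sum>k\<in>UNIV. dd k k t x)"

definition dens :: "real \<Rightarrow> real^'n \<Rightarrow> real" where "dens t x = v t x \<bullet> v t x"

definition kinetic :: "real \<Rightarrow> real" where
  "kinetic t = (LINT x|lborel. (\<Sum>k\<in>UNIV. d k t x \<bullet> d k t x))"

text \<open>For \<open>j = 1\<close> this is the mass, for \<open>j = m + 1\<close> the potential
  part of the energy up to a factor.\<close>

definition excess :: "nat \<Rightarrow> real \<Rightarrow> real" where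
  "excess j t = (LINT x|lborel. dens t x ^ j - 1)"

text \<open>As a real inner product, \<open>(\<i> * a) \<bullet> b = Im (cnj a * b)\<close>.\<close>

definition virial :: "real \<Rightarrow> real" where
  "virial t = (LINT x|lborel. (\<Sum>k\<in>UNIV. x $ k * ((\<i> * v t x) \<bullet> d k t x)))"

definition energy :: "real \<Rightarrow> real" where
  "energy t = kinetic t + \<epsilon> / real (m + 1) * excess (m + 1) t"

lemma dens_cmod: "dens t x = (cmod (v t x))\<^sup>2"
  by (simp add: dens_def power2_norm_eq_inner)

lemma i_V: "\<i> * V t x = complex_of_real (\<epsilon> * (dens t x ^ m - 1)) * v t x - L t x"
  using nls[of t x] by (simp add: L_def dens_cmod power_mult[symmetric] algebra_simps)

lemma V_eq: "V t x = \<i> * (L t x - (\<epsilon> * (dens t x ^ m - 1)) *\<^sub>R v t x)"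
proof -
  have "V t x = - (\<i> * (\<i> * V t x))" by (simp add: mult.assoc[symmetric])
  then show ?thesis by (simp only: i_V) (simp add: scaleR_conv_of_real algebra_simps)
qed

lemma bounded_v: "unif_bounded v"
  using unif_bounded_add[OF unif_decay_imp_bounded[OF decay_v] unif_bounded_const[of 1]] by simp

lemma decay_v_diff: "unif_decay (\<lambda>s x. v (f s) x - v (g s) x)"
  using unif_decay_diff[OF unif_decay_reindex[OF decay_v, of f] unif_decay_reindex[OF decay_v, of g]]
  by simp

lemma decay_L: "unif_decay L"
  unfolding L_def by (intro unif_decay_sum decay_dd)

lemma bounded_L: "unif_bounded L" and bounded_d: "unif_bounded (d k)"
  by (intro unif_decay_imp_bounded decay_L decay_d)+

lemma cont_L: "continuous_on UNIV (L t)"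
  unfolding L_def by (intro continuous_intros cont_dd)

lemma cont_dens: "continuous_on UNIV (dens t)"
  unfolding dens_def by (intro continuous_intros cont_v)

lemma cont_V: "continuous_on UNIV (V t)"
  unfolding V_eq by (intro continuous_intros cont_v cont_L cont_dens)

lemma decay_dens1: "unif_decay (\<lambda>t x. dens t x - 1)"
proof -
  have "unif_decay (\<lambda>t x. (v t x - 1) \<bullet> (v t x + 1))"
    by (intro unif_decay_inner decay_v unif_bounded_add bounded_v unif_bounded_const)
  moreover have "(v t x - 1) \<bullet> (v t x + 1) = dens t x - 1" for t x
    by (simp add: dens_def inner_complex_def algebra_simps)
  ultimately show ?thesis by simp
qed

lemma bounded_dens: "unif_bounded dens"
  using unif_bounded_add[OF unif_decay_imp_bounded[OF decay_dens1] unif_bounded_const[of 1]] by simp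

lemma decay_dens_power: "unif_decay (\<lambda>t x. dens t x ^ j - 1)"
proof (induction j)
  case (Suc j)
  have "unif_decay (\<lambda>t x. dens t x * (dens t x ^ j - 1) + (dens t x - 1))"
    by (intro unif_decay_add unif_decay_mult(2) Suc bounded_dens decay_dens1)
  then show ?case by (simp add: algebra_simps)
qed (simp add: unif_decay_0)

lemma bounded_dens_power: "unif_bounded (\<lambda>t x. dens t x ^ j)"
  using unif_bounded_add[OF unif_decay_imp_bounded[OF decay_dens_power] unif_bounded_const[of 1]] by simp

text \<open>The equation expresses \<open>V\<close> through the Laplacian and
  \<open>(dens ^ m - 1) * v\<close>, and both decay uniformly in time. All control of time
  increments of \<open>v\<close> comes from here.\<close>

lemma decay_V: "unif_decay V"
proof -
  have "unif_decay (\<lambda>t x. \<i> * (L t x - complex_of_real (\<epsilon> * (dens t x ^ m - 1)) * v t x))"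
    by (intro unif_decay_cmult unif_decay_diff decay_L unif_decay_mult bounded_v
        unif_decay_mono[OF unif_decay_cmult[OF decay_dens_power[of m], of \<epsilon>], where C = 1])
      (simp_all del: of_real_mult of_real_diff)
  then show ?thesis unfolding V_eq[abs_def] scaleR_conv_of_real .
qed

lemma dd_commute: "dd j k t x = dd k j t x"
  by (rule has_partial_commute[OF partial partial2 partial partial2])
    (use cont_dd in \<open>auto simp: continuous_on_eq_continuous_at\<close>)

lemma integrable_kinetic: "integrable lborel (\<lambda>x. \<Sum>k\<in>UNIV. d k t x \<bullet> d k t x)"
  by (rule integrable_unif_decay_continuous[where F = "\<lambda>t x. \<Sum>k\<in>UNIV. d k t x \<bullet> d k t x"])
    (intro unif_decay_sum unif_decay_inner decay_d bounded_d continuous_intros cont_d)+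

lemma integrable_excess: "integrable lborel (\<lambda>x. dens t x ^ j - 1)"
  by (rule integrable_unif_decay_continuous[where F = "\<lambda>t x. dens t x ^ j - 1"])
    (intro decay_dens_power continuous_intros cont_dens)+

lemma dens_deriv:
  "((\<lambda>s. dens s x ^ j) has_real_derivative real j * dens t x ^ (j - 1) * (2 * (v t x \<bullet> V t x))) (at t)"
proof -
  have "((\<lambda>s. dens s x) has_real_derivative 2 * (v t x \<bullet> V t x)) (at t)"
    using bounded_bilinear.has_vector_derivative[OF bounded_bilinear_inner time_deriv[of x t] time_deriv[of x t]]
    unfolding dens_def has_real_derivative_iff_has_vector_derivative by (simp add: inner_commute)
  from DERIV_power[OF this, of j] show ?thesis by (simp add: algebra_simps)
qed

lemma excess_deriv:
  "(excess j has_real_derivative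
    (LINT x|lborel. real j * dens t x ^ (j - 1) * (2 * (v t x \<bullet> V t x)))) (at t)"
  unfolding excess_def[abs_def]
proof (rule has_real_derivative_integral)
  show "((\<lambda>s. dens s x ^ j - 1) has_real_derivative
      real j * dens t x ^ (j - 1) * (2 * (v t x \<bullet> V t x))) (at t)" for t x
    using DERIV_diff[OF dens_deriv[where j = j] DERIV_const[of 1]] by simp
  have "unif_decay (\<lambda>t x. real j * (dens t x ^ (j - 1) * (2 * (v t x \<bullet> V t x))))"
    by (intro unif_decay_cmult unif_decay_mult(2) unif_decay_inner(2) decay_V bounded_v bounded_dens_power)
  then show "unif_decay (\<lambda>t x. real j * dens t x ^ (j - 1) * (2 * (v t x \<bullet> V t x)))"
    by (simp add: mult.assoc)
  show "unif_decay (\<lambda>t x. dens t x ^ j - 1)" by (rule decay_dens_power)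
  show "(\<lambda>x. dens t x ^ j - 1) \<in> borel_measurable borel" for t
    by (intro borel_measurable_continuous_onI continuous_intros cont_dens)
qed

text \<open>The decay comes from the derivatives of \<open>v\<close>, so the test function may be
  \<open>v\<close> or \<open>\<i> * v\<close>. The fixed \<open>f\<close> is viewed as a family over
  \<open>unit\<close> to fit the uniform notions.\<close>

lemma green:
  assumes part: "\<And>k. has_partial k f (f' k)"
    and cont: "continuous_on UNIV f" "\<And>k. continuous_on UNIV (f' k)"
    and bnd: "unif_bounded (\<lambda>_::unit. f)" "\<And>k. unif_bounded (\<lambda>_::unit. f' k)"
  shows "(LINT x|lborel. f x \<bullet> L t x) = - (LINT x|lborel. (\<Sum>k\<in>UNIV. f' k x \<bullet> d k t x))"
proof -
  let ?u = "\<lambda>g (_::unit). g t"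
  have dec: "unif_decay (?u (dd k k))" "unif_decay (?u (d k))" for k
    by (rule unif_decay_reindex[OF decay_dd] unif_decay_reindex[OF decay_d])+
  have 1: "(LINT x|lborel. f x \<bullet> dd k k t x) = - (LINT x|lborel. f' k x \<bullet> d k t x)" for k
    by (rule integral_parts[where i = k and F = "\<lambda>_::unit. f" and F' = "\<lambda>_::unit. f' k" and t = "()" and
        G = "?u (d k)" and G' = "?u (dd k k)"])

      (rule part partial2 cont cont_d cont_dd unif_decay_inner(2) dec bnd)+
  have "integrable lborel (\<lambda>x. f x \<bullet> dd k k t x)" for k
    by (rule integrable_unif_decay_continuous[where F = "\<lambda>(_::unit) x. f x \<bullet> dd k k t x"])
      (intro unif_decay_inner(2) dec bnd continuous_intros cont cont_dd)+
  moreover have "integrable lborel (\<lambda>x. f' k x \<bullet> d k t x)" for k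
    by (rule integrable_unif_decay_continuous[where F = "\<lambda>(_::unit) x. f' k x \<bullet> d k t x"])
      (intro unif_decay_inner(2) dec bnd continuous_intros cont cont_d)+
  ultimately show ?thesis
    by (simp add: L_def inner_sum_right 1 sum_negf)
qed

lemma green_v_diff:
  "(LINT x|lborel. (v a x - v b x) \<bullet> L t x)
    = - (LINT x|lborel. (\<Sum>k\<in>UNIV. (d k a x - d k b x) \<bullet> d k t x))"
  by (intro green has_partial_diff partial continuous_intros cont_v cont_d
      unif_decay_imp_bounded decay_v_diff unif_decay_diff)
    (rule unif_decay_reindex[OF decay_d])+

lemma green_self: "(LINT x|lborel. v t x \<bullet> L t x) = - kinetic t"
  unfolding kinetic_def
  by (intro green partial cont_v cont_d unif_bounded_reindex[OF bounded_v] unif_bounded_reindex[OF bounded_d])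

text \<open>After Green's formula the integrand is a sum of terms
  \<open>(\<i> * d k t x) \<bullet> d k t x\<close>, each zero. This phase invariance is what
  conserves mass.\<close>

lemma green_i_self: "(LINT x|lborel. (\<i> * v t x) \<bullet> L t x) = 0"
proof -
  have "(LINT x|lborel. (\<i> * v t x) \<bullet> L t x) = - (LINT x|lborel. (\<Sum>k\<in>UNIV. (\<i> * d k t x) \<bullet> d k t x))"
    by (intro green has_partial_bounded_linear[OF bounded_linear_mult_right] partial continuous_intros cont_v cont_d
        unif_bounded_cmult unif_bounded_reindex[OF bounded_v] unif_bounded_reindex[OF bounded_d])
  then show ?thesis by simp
qed

lemma integral_v_V: "(LINT x|lborel. v t x \<bullet> V t x) = 0"
proof -
  have "v t x \<bullet> V t x = - ((\<i> * v t x) \<bullet> L t x)" for x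
    unfolding V_eq inner_ii_left by (simp add: inner_diff_right right_diff_distrib)
  then show ?thesis using green_i_self by simp
qed

lemma excess_1_const: "(excess 1 has_real_derivative 0) (at t)"
  using excess_deriv[of 1 t] integral_v_V by simp

lemma integrable_v_diff_inner:
  assumes "unif_bounded g" "continuous_on UNIV (g t)"
  shows "integrable lborel (\<lambda>x. (v a x - v b x) \<bullet> g t x)"
  by (rule integrable_unif_decay_continuous[where F = "\<lambda>t x. (v a x - v b x) \<bullet> g t x"])
    (intro unif_decay_inner(1) decay_v_diff continuous_intros assms cont_v)+

definition grad_gap :: "real \<Rightarrow> real \<Rightarrow> real" where
  "grad_gap a b = (LINT x|lborel. (\<Sum>k\<in>UNIV. (d k a x - d k b x) \<bullet> (d k a x - d k b x)))"

lemma integrable_d_diff_inner: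
  "integrable lborel (\<lambda>x. \<Sum>k\<in>UNIV. (d k a x - d k b x) \<bullet> d k c x)"
proof (rule integrable_unif_decay_continuous[where F = "\<lambda>c x. \<Sum>k\<in>UNIV. (d k a x - d k b x) \<bullet> d k c x"])
  show "unif_decay (\<lambda>c x. \<Sum>k\<in>UNIV. (d k a x - d k b x) \<bullet> d k c x)"
    by (intro unif_decay_sum unif_decay_inner(2) decay_d unif_decay_imp_bounded[OF unif_decay_diff]
        unif_decay_reindex[OF decay_d])
qed (intro continuous_intros cont_d)

text \<open>The right-hand side is symmetric in the two pairs of times. Hence the Laplacian can be
  moved from one time increment of \<open>v\<close> to another.\<close>

lemma green_v_diff_L_diff:
  "(LINT x|lborel. (v a x - v b x) \<bullet> (L s x - L t x))
    = - (LINT x|lborel. (\<Sum>k\<in>UNIV. (d k a x - d k b x) \<bullet> (d k s x - d k t x)))"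
proof -
  have "(LINT x|lborel. (v a x - v b x) \<bullet> (L s x - L t x)) =
      (LINT x|lborel. (v a x - v b x) \<bullet> L s x) - (LINT x|lborel. (v a x - v b x) \<bullet> L t x)"
    by (simp add: inner_diff_right integrable_v_diff_inner bounded_L cont_L)
  also have "\<dots> = - (LINT x|lborel. (\<Sum>k\<in>UNIV. (d k a x - d k b x) \<bullet> (d k s x - d k t x)))"
    unfolding green_v_diff by (simp add: inner_diff_right sum_subtractf integrable_d_diff_inner)
  finally show ?thesis .
qed

end

subsection \<open>Conservation of mass and energy\<close>

context nls_flow
begin

definition quot :: "real \<Rightarrow> real \<Rightarrow> real^'n \<Rightarrow> complex" where
  "quot a h x = (v (a + h) x - v a x) /\<^sub>R h"

text \<open>The index of the family is the step \<open>h\<close>. The mean value inequality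
  transfers the bound on \<open>V\<close>; at \<open>h = 0\<close> the quotient is 0 by the
  convention for \<open>inverse\<close>.\<close>

lemma decay_quot: "unif_decay (quot a)"
proof -
  obtain C c where C: "C \<ge> 0" "c > 0" "\<And>t x. norm (V t x) \<le> C * exp (- c * norm x)"
    using unif_decayE[OF decay_V] by blast
  have "norm (quot a h x) \<le> C * exp (- c * norm x)" for h x
  proof -
    have "norm (v (a + h) x - v a x) \<le> C * exp (- c * norm x) * norm (a + h - a)"
    proof (rule differentiable_bound[where S = UNIV and f' = "\<lambda>s r. r *\<^sub>R V s x"])
      show "((\<lambda>s. v s x) has_derivative (\<lambda>r. r *\<^sub>R V s x)) (at s within UNIV)" for s
        using time_deriv[of x s] by (simp add: has_vector_derivative_def)
      show "onorm (\<lambda>r. r *\<^sub>R V s x) \<le> C * exp (- c * norm x)" for s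
        using C(3)[of s x] by (intro onorm_le) (simp add: mult.commute mult_left_mono)
    qed simp_all
    then show ?thesis using C(1) by (cases "h = 0")
      (simp_all add: quot_def inverse_eq_divide pos_divide_le_eq mult_ac)
  qed
  then show ?thesis using C(2) unfolding unif_decay_def by blast
qed

lemma cont_quot: "continuous_on UNIV (quot a h)"
  unfolding quot_def by (intro continuous_intros cont_v)

lemma quot_tendsto: "((\<lambda>h. quot a h x) \<longlongrightarrow> V a x) (at 0)"
proof -
  have "((\<lambda>h. norm (v (a + h) x - v a x - h *\<^sub>R V a x) / norm h) \<longlongrightarrow> 0) (at 0)"
    using time_deriv[of x a] unfolding has_vector_derivative_def has_derivative_at by blast
  moreover have "\<forall>\<^sub>F h in at 0. norm (v (a + h) x - v a x - h *\<^sub>R V a x) / norm h = norm (quot a h x - V a x)"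
    using eventually_neq_at_within[of 0 0 UNIV]
  proof eventually_elim
    case (elim h)
    then have "quot a h x - V a x = (v (a + h) x - v a x - h *\<^sub>R V a x) /\<^sub>R h"
      by (simp add: quot_def scaleR_diff_right)
    then show ?case by (simp add: divide_inverse_commute)
  qed
  ultimately have "((\<lambda>h. norm (quot a h x - V a x)) \<longlongrightarrow> 0) (at 0)"
    by (rule Lim_transform_eventually)
  then show ?thesis by (simp add: tendsto_norm_zero_iff LIM_zero_iff)
qed

text \<open>Subtracting \<open>v a\<close>, constant in time, makes the pairing integrable for a
  merely bounded \<open>g\<close>. It is applied with a Laplacian, a difference of Laplacians, and a
  multiple of \<open>dil a\<close>.\<close>

lemma v_diff_inner_deriv:
  assumes "unif_bounded (\<lambda>_::real. g)" "continuous_on UNIV g"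
  shows "((\<lambda>s. LINT x|lborel. (v s x - v a x) \<bullet> g x) has_real_derivative
      (LINT x|lborel. V t x \<bullet> g x)) (at t)"
proof (rule has_real_derivative_integral)
  show "((\<lambda>s. (v s x - v a x) \<bullet> g x) has_real_derivative V t x \<bullet> g x) (at t)" for t x
    unfolding has_real_derivative_iff_has_vector_derivative
    by (rule bounded_linear.has_vector_derivative[OF bounded_linear_inner_left])
      (use time_deriv in \<open>auto intro!: derivative_eq_intros\<close>)
  show "unif_decay (\<lambda>s x. (v s x - v a x) \<bullet> g x)" "unif_decay (\<lambda>s x. V s x \<bullet> g x)"
    by (intro unif_decay_inner(1) decay_v_diff decay_V assms(1))+
  show "(\<lambda>x. (v t x - v a x) \<bullet> g x) \<in> borel_measurable borel" for t
    by (intro borel_measurable_continuous_onI continuous_intros cont_v assms(2))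
qed

text \<open>Only boundedness of \<open>L (a + h) - L a\<close> is known as \<open>h \<rightarrow> 0\<close>. The quotient \<open>quot a h\<close> is
  replaced by \<open>quot a s\<close> with \<open>s\<close> fixed, up to a small error in \<open>L\<^sup>1\<close>, and Green's formula moves the
  Laplacian onto \<open>quot a s\<close>.\<close>

lemma grad_gap_little_o: "((\<lambda>h. grad_gap (a + h) a / h) \<longlongrightarrow> 0) (at 0)"
proof (rule tendstoI)
  fix e :: real assume "e > 0"
  obtain B0 where "\<And>t x. norm (L t x) \<le> B0" using bounded_L unfolding unif_bounded_def by blast
  then have "norm (L t x - L s x) \<le> 2 * B0" for t s x
    using norm_triangle_ineq4[of "L t x" "L s x"] by (smt (verit))
  then obtain B where B: "B > 0" "\<And>t s x. norm (L t x - L s x) \<le> B"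
    by (metis less_max_iff_disj max.cobounded1 order_trans zero_less_one)
  obtain W c where W: "W \<ge> 0" "c > 0" "\<And>h x. norm (quot a h x) \<le> W * exp (- c * norm x)"
    using unif_decayE[OF decay_quot] by blast
  let ?A = "\<lambda>h. LINT x|lborel. norm (quot a h x - V a x)"
  have A: "(?A \<longlongrightarrow> 0) (at 0)"
    by (rule integral_tendsto_dominated_at(3)[OF _ quot_tendsto W(3)])
      (use cont_quot W(2) in \<open>auto intro!: borel_measurable_continuous_onI
        integrable_mult_right integrable_exp_decay[simplified]\<close>)
  \<comment> \<open>The error is split into three parts below \<open>e / 3\<close>: the L^1
    distances of \<open>quot a h\<close> and of \<open>quot a s\<close> from \<open>V a\<close>,
    each times the bound \<open>B\<close>, and \<open>Z h / s\<close>.\<close>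
  have Asmall: "\<forall>\<^sub>F h in at 0. ?A h < e / (3 * B)"
    by (rule order_tendstoD(2)[OF A]) (intro divide_pos_pos mult_pos_pos \<open>e > 0\<close> B(1), simp)
  then obtain s where s: "s \<noteq> 0" "?A s < e / (3 * B)"
    using eventually_happens[OF eventually_conj[OF Asmall eventually_neq_at_within[of 0 0 UNIV]]] by auto
  define Z where "Z h = (LINT x|lborel. (v (a + h) x - v a x) \<bullet> (L (a + s) x - L a x))" for h
  have "((\<lambda>t. LINT x|lborel. (v t x - v a x) \<bullet> (L (a + s) x - L a x)) has_real_derivative
      (LINT x|lborel. V a x \<bullet> (L (a + s) x - L a x))) (at a)"
    by (intro v_diff_inner_deriv continuous_intros cont_L) (use B in \<open>auto simp: unif_bounded_def\<close>)
  from DERIV_isCont[OF this] have "(Z \<longlongrightarrow> 0) (at 0)"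
    unfolding Z_def isCont_iff by simp
  then have Zsmall: "\<forall>\<^sub>F h in at 0. \<bar>Z h\<bar> < e / 3 * \<bar>s\<bar>"
    using \<open>e > 0\<close> s(1) by (auto dest!: tendstoD[where e = "e / 3 * \<bar>s\<bar>"])
  \<comment> \<open>By the symmetry of Green's formula in the two increments, the varying Laplacian
    is traded for the fixed one \<open>L (a + s) - L a\<close>. Against a fixed bounded function the
    increment of \<open>v\<close> tends to 0.\<close>
  have swap: "(LINT x|lborel. quot a s x \<bullet> (L (a + h) x - L a x)) = Z h / s" for h
  proof -
    have "(LINT x|lborel. (v (a + s) x - v a x) \<bullet> (L (a + h) x - L a x)) = Z h"
      unfolding Z_def green_v_diff_L_diff by (simp add: inner_commute)
    then show ?thesis by (simp add: quot_def divide_inverse_commute)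
  qed
  have int_quot: "integrable lborel (\<lambda>x. quot a r x \<bullet> (L (a + h) x - L a x))" for r h
    by (simp add: quot_def inner_diff_right integrable_v_diff_inner bounded_L cont_L)
  show "\<forall>\<^sub>F h in at 0. dist (grad_gap (a + h) a / h) 0 < e"
    using Asmall Zsmall eventually_neq_at_within[of 0 0 UNIV]
  proof eventually_elim
    case (elim h)
    have intA: "integrable lborel (\<lambda>x. norm (quot a r x - V a x))" for r
      by (rule integrable_norm, rule integrable_unif_decay_continuous[where F = "\<lambda>r x. quot a r x - V a x"])
        (intro unif_decay_diff decay_quot unif_decay_reindex[OF decay_V] continuous_intros cont_quot cont_V)+
    have "grad_gap (a + h) a / h = - (LINT x|lborel. quot a h x \<bullet> (L (a + h) x - L a x))"
      unfolding grad_gap_def using green_v_diff_L_diff[of "a + h" a "a + h" a]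
      by (simp add: quot_def divide_inverse_commute)
    also have "(LINT x|lborel. quot a h x \<bullet> (L (a + h) x - L a x)) =
        (LINT x|lborel. (quot a h x - quot a s x) \<bullet> (L (a + h) x - L a x)) + Z h / s"
      unfolding swap[symmetric] by (simp add: inner_diff_left int_quot)
    finally have "\<bar>grad_gap (a + h) a / h\<bar> \<le>
        \<bar>LINT x|lborel. (quot a h x - quot a s x) \<bullet> (L (a + h) x - L a x)\<bar> + \<bar>Z h / s\<bar>"
      by linarith
    also have "\<bar>LINT x|lborel. (quot a h x - quot a s x) \<bullet> (L (a + h) x - L a x)\<bar>
        \<le> (LINT x|lborel. B * (norm (quot a h x - V a x) + norm (quot a s x - V a x)))"
    proof (rule order_trans[OF integral_abs_bound], rule integral_mono)
      show "integrable lborel (\<lambda>x. \<bar>(quot a h x - quot a s x) \<bullet> (L (a + h) x - L a x)\<bar>)"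
        by (simp add: inner_diff_left int_quot)
      fix x
      have "\<bar>(quot a h x - quot a s x) \<bullet> (L (a + h) x - L a x)\<bar>
          \<le> norm (quot a h x - quot a s x) * norm (L (a + h) x - L a x)"
        by (rule Cauchy_Schwarz_ineq2)
      also have "\<dots> \<le> (norm (quot a h x - V a x) + norm (quot a s x - V a x)) * B"
        using norm_triangle_ineq4[of "quot a h x - V a x" "quot a s x - V a x"]
        by (intro mult_mono B) simp_all
      finally show "\<bar>(quot a h x - quot a s x) \<bullet> (L (a + h) x - L a x)\<bar>
        \<le> B * (norm (quot a h x - V a x) + norm (quot a s x - V a x))" by (simp add: mult.commute)
    qed (simp add: intA)
    also have "\<dots> = B * ?A h + B * ?A s" by (simp add: intA algebra_simps)
    also have "\<dots> < e / 3 + e / 3"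
      using elim(1) s(2) B(1) by (intro add_strict_mono) (simp_all add: field_simps)
    also have "\<bar>Z h / s\<bar> < e / 3" using elim(2) s(1) by (simp add: field_simps)
    finally show ?case by simp
  qed
qed

text \<open>The expansion |a|^2 - |b|^2 = 2 (a - b) b + |a - b|^2 is applied to the gradients.
  Green's formula turns the linear term into a pairing of \<open>v\<close> with a fixed Laplacian,
  and the quadratic one is \<open>grad_gap\<close>, of order o(h).\<close>

lemma kinetic_deriv:
  "(kinetic has_real_derivative (LINT x|lborel. - 2 * (V a x \<bullet> L a x))) (at a)"
proof -
  let ?N = "\<lambda>t. LINT x|lborel. (v t x - v a x) \<bullet> L a x"
  have N: "(?N has_real_derivative (LINT x|lborel. V a x \<bullet> L a x)) (at a)"
    by (intro v_diff_inner_deriv unif_bounded_reindex[OF bounded_L] cont_L)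
  have "kinetic (a + h) - kinetic a = - 2 * ?N (a + h) + grad_gap (a + h) a" for h
  proof -
    have i1: "integrable lborel (\<lambda>x. \<Sum>k\<in>UNIV. (d k (a + h) x - d k a x) \<bullet> (d k (a + h) x - d k a x))"
      using integrable_d_diff_inner[of "a + h" a "a + h"] integrable_d_diff_inner[of "a + h" a a]
      by (simp add: inner_diff_right sum_subtractf)
    have "kinetic (a + h) - kinetic a =
        (LINT x|lborel. (\<Sum>k\<in>UNIV. d k (a + h) x \<bullet> d k (a + h) x) - (\<Sum>k\<in>UNIV. d k a x \<bullet> d k a x))"
      unfolding kinetic_def by (simp add: integrable_kinetic)
    also have "\<dots> = (LINT x|lborel. 2 * (\<Sum>k\<in>UNIV. (d k (a + h) x - d k a x) \<bullet> d k a x)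
        + (\<Sum>k\<in>UNIV. (d k (a + h) x - d k a x) \<bullet> (d k (a + h) x - d k a x)))"
      by (intro Bochner_Integration.integral_cong refl)
        (simp add: sum_distrib_left sum.distrib[symmetric] sum_subtractf[symmetric] inner_diff_left
          inner_diff_right inner_commute algebra_simps)
    also have "\<dots> = 2 * (LINT x|lborel. (\<Sum>k\<in>UNIV. (d k (a + h) x - d k a x) \<bullet> d k a x)) + grad_gap (a + h) a"
      unfolding grad_gap_def by (simp add: integrable_d_diff_inner i1)
    finally show ?thesis by (simp add: green_v_diff)
  qed
  then have "(\<lambda>h. (kinetic (a + h) - kinetic a) / h)
      = (\<lambda>h. - 2 * ((?N (a + h) - ?N a) / h) + grad_gap (a + h) a / h)"
    by (simp add: diff_divide_distrib add_divide_distrib)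
  moreover have "((\<lambda>h. - 2 * ((?N (a + h) - ?N a) / h) + grad_gap (a + h) a / h)
      \<longlongrightarrow> - 2 * (LINT x|lborel. V a x \<bullet> L a x) + 0) (at 0)"
    using N grad_gap_little_o[of a] unfolding DERIV_def by (intro tendsto_intros)
  ultimately show ?thesis unfolding DERIV_def by simp
qed

text \<open>Pairing the equation with \<open>V\<close> uses
  \<open>V \<bullet> (\<i> * V) = 0\<close>. Since the nonlinearity contains \<open>- 1\<close>,
  what remains is a multiple of the integral of \<open>V \<bullet> v\<close>, which vanishes by
  conservation of mass.\<close>

lemma energy_const: "(energy has_real_derivative 0) (at t)"
proof -
  have dV: "unif_decay (\<lambda>t x. V t x \<bullet> g t x)" if "unif_bounded g" for g
    using that by (intro unif_decay_inner(1) decay_V)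
  have i1: "integrable lborel (\<lambda>x. V t x \<bullet> L t x)" "integrable lborel (\<lambda>x. V t x \<bullet> v t x)"
    by (rule integrable_unif_decay_continuous[OF dV]; intro bounded_L bounded_v continuous_intros cont_L cont_V cont_v)+
  have "unif_decay (\<lambda>t x. dens t x ^ m * (V t x \<bullet> v t x))"
    by (intro unif_decay_mult(2) dV bounded_v bounded_dens_power)
  then have i2: "integrable lborel (\<lambda>x. dens t x ^ m * (V t x \<bullet> v t x))"
    by (rule integrable_unif_decay_continuous) (intro continuous_intros cont_dens cont_V cont_v)
  have "(energy has_real_derivative (LINT x|lborel. - 2 * (V t x \<bullet> L t x)) + \<epsilon> / real (m + 1) *
     (LINT x|lborel. real (m + 1) * dens t x ^ (m + 1 - 1) * (2 * (v t x \<bullet> V t x)))) (at t)"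
    unfolding energy_def[abs_def] by (intro DERIV_add DERIV_cmult kinetic_deriv excess_deriv)
  moreover have "(LINT x|lborel. - 2 * (V t x \<bullet> L t x)) + \<epsilon> / real (m + 1) *
     (LINT x|lborel. real (m + 1) * dens t x ^ (m + 1 - 1) * (2 * (v t x \<bullet> V t x)))
     = (LINT x|lborel. - 2 * (V t x \<bullet> L t x) + 2 * \<epsilon> * (dens t x ^ m * (V t x \<bullet> v t x)))"
    using i1 i2 by (simp add: inner_commute mult.assoc mult.left_commute)
  also have "\<dots> = (LINT x|lborel. 2 * \<epsilon> * (V t x \<bullet> v t x))"
  proof (intro Bochner_Integration.integral_cong refl)
    fix x
    have "V t x \<bullet> (\<i> * V t x) = \<epsilon> * (dens t x ^ m - 1) * (V t x \<bullet> v t x) - V t x \<bullet> L t x"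
      unfolding i_V scaleR_conv_of_real[symmetric] by (simp only: inner_diff_right inner_scaleR_right)
    then show "- 2 * (V t x \<bullet> L t x) + 2 * \<epsilon> * (dens t x ^ m * (V t x \<bullet> v t x)) = 2 * \<epsilon> * (V t x \<bullet> v t x)"
      by (simp add: algebra_simps)
  qed
  also have "\<dots> = 0" using integral_v_V[of t] i1(2) by (simp add: inner_commute)
  finally show ?thesis by (simp only:)
qed

end

subsection \<open>The virial functional\<close>

context nls_flow
begin

text \<open>Twice the generator of the dilations that preserve the L^2 norm, x . grad + n/2. The
  term in \<open>v\<close> is the divergence of x, produced by integration by parts.\<close>

definition dil :: "real \<Rightarrow> real^'n \<Rightarrow> complex" where
  "dil t x = (\<Sum>k\<in>UNIV. 2 *\<^sub>R (x $ k *\<^sub>R d k t x)) + real CARD('n) *\<^sub>R v t x"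

lemma bounded_dil: "unif_bounded dil"
  unfolding dil_def[abs_def]
  by (intro unif_bounded_add unif_decay_imp_bounded[OF unif_decay_sum] unif_decay_scaleR
      unif_decay_component_scaleR decay_d unif_bounded_scaleR bounded_v)

lemma cont_dil: "continuous_on UNIV (dil t)"
  unfolding dil_def by (intro continuous_intros cont_d cont_v)

lemma decay_d_diff: "unif_decay (\<lambda>s x. d k (f s) x - d k (g s) x)"
  by (intro unif_decay_diff unif_decay_reindex[OF decay_d])

text \<open>The functional is bilinear in \<open>v\<close> and its gradient, so its increment has
  two linear terms and a quadratic one. The linear term with the gradient of the increment is
  integrated by parts, after which the linear part involves the increment of \<open>v\<close>
  alone.\<close>

lemma virial_diff:
  "virial b - virial a = (LINT x|lborel. (v b x - v a x) \<bullet> (- (\<i> * dil a x)))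
    + (LINT x|lborel. (\<Sum>k\<in>UNIV. x $ k * ((\<i> * (v b x - v a x)) \<bullet> (d k b x - d k a x))))"
proof -
  let ?w = "\<lambda>(b::real) x. v b x - v a x" and ?w' = "\<lambda>k (b::real) x. d k b x - d k a x"
  have bv: "unif_bounded (\<lambda>b::real. v a)" "unif_bounded (\<lambda>b::real. d k a)" for k
    by (rule unif_bounded_reindex[OF bounded_v] unif_bounded_reindex[OF bounded_d])+
  have bw: "unif_bounded (?w' k)" for k
    by (intro unif_decay_imp_bounded decay_d_diff)
  have dw: "unif_decay (\<lambda>b x. \<i> * ?w b x)"
    by (intro unif_decay_cmult decay_v_diff)
  have dec: "unif_decay (\<lambda>b x. x $ k * ((\<i> * ?w b x) \<bullet> d k a x))"
    "unif_decay (\<lambda>b x. x $ k * ((\<i> * v a x) \<bullet> ?w' k b x))"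
    "unif_decay (\<lambda>b x. (\<i> * ?w b x) \<bullet> v a x)"
    "unif_decay (\<lambda>b x. x $ k * ((\<i> * ?w b x) \<bullet> ?w' k b x))"
    "unif_decay (\<lambda>b x. x $ k * ((\<i> * v b x) \<bullet> d k b x))" for k
    by (intro unif_decay_component_mult unif_decay_inner(1)[OF dw] unif_decay_inner(2)[OF decay_d_diff]
        unif_decay_inner(2)[OF decay_d] unif_bounded_cmult bv bw bounded_v)+
  have int: "integrable lborel (\<lambda>x. x $ k * ((\<i> * ?w b x) \<bullet> d k a x))"
    "integrable lborel (\<lambda>x. x $ k * ((\<i> * v a x) \<bullet> ?w' k b x))"
    "integrable lborel (\<lambda>x. (\<i> * ?w b x) \<bullet> v a x)"
    "integrable lborel (\<lambda>x. x $ k * ((\<i> * ?w b x) \<bullet> ?w' k b x))"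
    "integrable lborel (\<lambda>x. x $ k * ((\<i> * v b x) \<bullet> d k b x))" for k b
    by (rule integrable_unif_decay_continuous[OF dec(1), where t = b]
        integrable_unif_decay_continuous[OF dec(2), where t = b]
        integrable_unif_decay_continuous[OF dec(3), where t = b]
        integrable_unif_decay_continuous[OF dec(4), where t = b]
        integrable_unif_decay_continuous[OF dec(5), where t = b], intro continuous_intros cont_v cont_d)+
  have parts: "(LINT x|lborel. x $ k * ((\<i> * v a x) \<bullet> ?w' k b x))
      = (LINT x|lborel. (\<i> * ?w b x) \<bullet> v a x) + (LINT x|lborel. x $ k * ((\<i> * ?w b x) \<bullet> d k a x))" for k
  proof -
    let ?f = "\<lambda>b x. x $ k * ((\<i> * ?w b x) \<bullet> v a x)"
    \<comment> \<open>The minus sign comes from the antisymmetry of the form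
      \<open>(\<i> * a) \<bullet> b\<close>.\<close>
    let ?f' = "\<lambda>b x. (\<i> * ?w b x) \<bullet> v a x + (x $ k * ((\<i> * ?w b x) \<bullet> d k a x) - x $ k * ((\<i> * v a x) \<bullet> ?w' k b x))"
    have "(LINT x|lborel. ?f' b x) = 0"
    proof (rule integral_partial_eq_0[where F = ?f and F' = ?f' and i = k and t = b])
      have "has_partial k (?f b) (\<lambda>x. (if k = k then (\<i> * ?w b x) \<bullet> v a x else 0)
          + x $ k * ((\<i> * ?w b x) \<bullet> d k a x + (\<i> * ?w' k b x) \<bullet> v a x))"
        by (intro has_partial_component_mult has_partial_inner partial has_partial_diff
            has_partial_bounded_linear[OF bounded_linear_mult_right])
      moreover have "(if k = k then (\<i> * ?w b x) \<bullet> v a x else 0)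
          + x $ k * ((\<i> * ?w b x) \<bullet> d k a x + (\<i> * ?w' k b x) \<bullet> v a x) = ?f' b x" for x
        by (simp add: inner_complex_def algebra_simps)
      ultimately show "has_partial k (?f b) (?f' b)" by (simp only:)
      show "unif_decay ?f"
        by (intro unif_decay_component_mult dec(3))
      show "unif_decay ?f'"
        by (intro unif_decay_add unif_decay_diff dec)
      show "?f b \<in> borel_measurable borel"
        by (intro borel_measurable_continuous_onI continuous_intros cont_v)
    qed
    then show ?thesis by (simp add: int)
  qed
  have "virial b - virial a
      = (LINT x|lborel. (\<Sum>k\<in>UNIV. x $ k * ((\<i> * v b x) \<bullet> d k b x) - x $ k * ((\<i> * v a x) \<bullet> d k a x)))"
    unfolding virial_def by (simp add: int sum_subtractf)
  also have "\<dots> = (LINT x|lborel. (\<Sum>k\<in>UNIV. x $ k * ((\<i> * ?w b x) \<bullet> ?w' k b x)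
      + x $ k * ((\<i> * ?w b x) \<bullet> d k a x) + x $ k * ((\<i> * v a x) \<bullet> ?w' k b x)))"
    by (intro Bochner_Integration.integral_cong sum.cong refl)
      (simp add: right_diff_distrib inner_diff_left inner_diff_right)
  also have "\<dots> = (LINT x|lborel. (\<Sum>k\<in>UNIV. x $ k * ((\<i> * ?w b x) \<bullet> ?w' k b x)))
      + ((\<Sum>k\<in>UNIV. 2 * (LINT x|lborel. x $ k * ((\<i> * ?w b x) \<bullet> d k a x)))
        + real CARD('n) * (LINT x|lborel. (\<i> * ?w b x) \<bullet> v a x))"
  proof -
    have "(LINT x|lborel. (\<Sum>k\<in>UNIV. A k x + B k x + D k x)) = (LINT x|lborel. (\<Sum>k\<in>UNIV. A k x))
        + ((\<Sum>k\<in>UNIV. 2 * (LINT x|lborel. B k x)) + real CARD('n) * W)"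
      if "\<And>k. integrable lborel (A k)" "\<And>k. integrable lborel (B k)" "\<And>k. integrable lborel (D k)"
        "\<And>k. (LINT x|lborel. D k x) = W + (LINT x|lborel. B k x)"
      for A B D :: "'n \<Rightarrow> real^'n \<Rightarrow> real" and W
      using that by (simp add: sum.distrib sum_distrib_left[symmetric])
    then show ?thesis by this (intro int parts)+
  qed
  also have "(\<Sum>k\<in>UNIV. 2 * (LINT x|lborel. x $ k * ((\<i> * ?w b x) \<bullet> d k a x)))
        + real CARD('n) * (LINT x|lborel. (\<i> * ?w b x) \<bullet> v a x)
      = (LINT x|lborel. (\<Sum>k\<in>UNIV. 2 * (x $ k * ((\<i> * ?w b x) \<bullet> d k a x))) + real CARD('n) * ((\<i> * ?w b x) \<bullet> v a x))"
    by (simp add: int)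
  also have "\<dots> = (LINT x|lborel. ?w b x \<bullet> (- (\<i> * dil a x)))"
  proof (intro Bochner_Integration.integral_cong refl)
    fix x
    have "?w b x \<bullet> (- (\<i> * dil a x)) = (\<i> * ?w b x) \<bullet> dil a x"
      by (simp add: inner_ii_left)
    then show "(\<Sum>k\<in>UNIV. 2 * (x $ k * ((\<i> * ?w b x) \<bullet> d k a x))) + real CARD('n) * ((\<i> * ?w b x) \<bullet> v a x)
        = ?w b x \<bullet> (- (\<i> * dil a x))"
      by (simp only: dil_def inner_add_right inner_sum_right inner_scaleR_right)
  qed
  finally show ?thesis by simp
qed

text \<open>In pq \<le> p^2 + q^2 the weight is put on the increment of \<open>v\<close>. Then p^2
  is \<open>h\<^sup>2\<close> times a weighted square of \<open>quot a h\<close>, whose integral is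
  bounded in \<open>h\<close>, and the q^2 terms integrate to \<open>grad_gap\<close>.\<close>

lemma virial_remainder_bound:
  obtains C where "C \<ge> 0" "\<And>h. h \<noteq> 0 \<Longrightarrow>
    \<bar>(LINT x|lborel. (\<Sum>k\<in>UNIV. x $ k * ((\<i> * (v (a + h) x - v a x)) \<bullet> (d k (a + h) x - d k a x)))) / h\<bar>
      \<le> C * \<bar>h\<bar> + \<bar>grad_gap (a + h) a / h\<bar>"
proof -
  let ?w' = "\<lambda>k h x. d k (a + h) x - d k a x"
  let ?S = "\<lambda>h x. \<Sum>k\<in>UNIV. (x $ k *\<^sub>R quot a h x) \<bullet> (x $ k *\<^sub>R quot a h x)"
  have decS: "unif_decay ?S"
    by (intro unif_decay_sum unif_decay_inner(1) unif_decay_imp_bounded unif_decay_component_scaleR decay_quot)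
  have contS: "continuous_on UNIV (?S h)" for h
    by (intro continuous_intros cont_quot)
  have intS: "integrable lborel (?S h)" for h
    by (rule integrable_unif_decay_continuous[OF decS contS])
  obtain B where "\<And>h. ?S h \<in> borel_measurable borel \<Longrightarrow> norm (LINT x|lborel. ?S h x) \<le> B"
    by (rule unif_decay_integral_bound[OF decS]) blast
  then have B: "norm (LINT x|lborel. ?S h x) \<le> B" for h
    using borel_measurable_continuous_onI[OF contS] by blast
  have intR: "integrable lborel (\<lambda>x. \<Sum>k\<in>UNIV. ?w' k h x \<bullet> ?w' k h x)" for h
    using integrable_d_diff_inner[of "a + h" a "a + h"] integrable_d_diff_inner[of "a + h" a a]
    by (simp add: inner_diff_right sum_subtractf)
  show ?thesis
  proof (rule that[of "\<bar>B\<bar>"])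
    fix h :: real assume h: "h \<noteq> 0"
    let ?Q = "\<lambda>x. \<Sum>k\<in>UNIV. x $ k * ((\<i> * (v (a + h) x - v a x)) \<bullet> ?w' k h x)"
    have pw: "\<bar>?Q x\<bar> \<le> h\<^sup>2 * ?S h x + (\<Sum>k\<in>UNIV. ?w' k h x \<bullet> ?w' k h x)" for x
    proof -
      have "\<bar>x $ k * ((\<i> * (v (a + h) x - v a x)) \<bullet> ?w' k h x)\<bar>
          \<le> h\<^sup>2 * ((x $ k *\<^sub>R quot a h x) \<bullet> (x $ k *\<^sub>R quot a h x)) + ?w' k h x \<bullet> ?w' k h x" for k
      proof -
        let ?p = "\<bar>x $ k\<bar> * norm (v (a + h) x - v a x)" and ?q = "norm (?w' k h x)"
        have "\<bar>x $ k * ((\<i> * (v (a + h) x - v a x)) \<bullet> ?w' k h x)\<bar> \<le> ?p * ?q"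
          using Cauchy_Schwarz_ineq2[of "\<i> * (v (a + h) x - v a x)" "?w' k h x"]
          by (simp add: abs_mult mult.assoc mult_left_mono norm_mult)
        also have "\<dots> \<le> ?p\<^sup>2 + ?q\<^sup>2"
        proof -
          have "0 \<le> ?p * ?q" by simp
          with sum_squares_bound[of ?p ?q] show ?thesis by linarith
        qed
        also have "?q\<^sup>2 = ?w' k h x \<bullet> ?w' k h x" by (rule power2_norm_eq_inner)
        also have "?p\<^sup>2 = h\<^sup>2 * ((x $ k *\<^sub>R quot a h x) \<bullet> (x $ k *\<^sub>R quot a h x))"
        proof -
          have n: "norm (v (a + h) x - v a x) = \<bar>h\<bar> * norm (quot a h x)"
            using h by (simp add: quot_def)
          show ?thesis unfolding n power2_norm_eq_inner[symmetric] by (simp add: power_mult_distrib)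
        qed
        finally show ?thesis .
      qed
      then have "\<bar>?Q x\<bar> \<le> (\<Sum>k\<in>UNIV. h\<^sup>2 * ((x $ k *\<^sub>R quot a h x) \<bullet> (x $ k *\<^sub>R quot a h x)) + ?w' k h x \<bullet> ?w' k h x)"
        by (intro order_trans[OF sum_abs] sum_mono)
      then show ?thesis by (simp only: sum.distrib sum_distrib_left)
    qed
    have "\<bar>LINT x|lborel. ?Q x\<bar> \<le> (LINT x|lborel. h\<^sup>2 * ?S h x + (\<Sum>k\<in>UNIV. ?w' k h x \<bullet> ?w' k h x))"
    proof (rule order_trans[OF integral_abs_bound], rule integral_mono[OF integrable_abs _ pw])
      show i: "integrable lborel (\<lambda>x. h\<^sup>2 * ?S h x + (\<Sum>k\<in>UNIV. ?w' k h x \<bullet> ?w' k h x))"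
        by (intro Bochner_Integration.integrable_add integrable_mult_right intS intR)
      show "integrable lborel ?Q"
      proof (rule Bochner_Integration.integrable_bound[OF i])
        have "continuous_on UNIV ?Q" by (intro continuous_intros cont_v cont_d)
        then show "?Q \<in> borel_measurable lborel" by (simp add: borel_measurable_continuous_onI)
        show "AE x in lborel. norm (?Q x) \<le> norm (h\<^sup>2 * ?S h x + (\<Sum>k\<in>UNIV. ?w' k h x \<bullet> ?w' k h x))"
          by (rule AE_I2, unfold real_norm_def, rule order_trans[OF pw abs_ge_self])
      qed
    qed
    also have "\<dots> = h\<^sup>2 * (LINT x|lborel. ?S h x) + grad_gap (a + h) a"
      unfolding grad_gap_def by (simp only: integral_mult_right_zero
        Bochner_Integration.integral_add[OF integrable_mult_right[OF intS] intR])
    also have "\<dots> \<le> h\<^sup>2 * \<bar>B\<bar> + \<bar>grad_gap (a + h) a\<bar>"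
      using B[of h] by (intro add_mono mult_left_mono) auto
    finally have "\<bar>LINT x|lborel. ?Q x\<bar> / \<bar>h\<bar> \<le> (h\<^sup>2 * \<bar>B\<bar> + \<bar>grad_gap (a + h) a\<bar>) / \<bar>h\<bar>"
      by (rule divide_right_mono) simp
    also have "\<dots> = \<bar>B\<bar> * \<bar>h\<bar> + \<bar>grad_gap (a + h) a / h\<bar>"
    proof -
      have h2: "h\<^sup>2 = \<bar>h\<bar> * \<bar>h\<bar>" by (simp add: power2_eq_square)
      show ?thesis unfolding h2 add_divide_distrib abs_divide mult.assoc using h by simp
    qed
    finally show "\<bar>(LINT x|lborel. ?Q x) / h\<bar> \<le> \<bar>B\<bar> * \<bar>h\<bar> + \<bar>grad_gap (a + h) a / h\<bar>" by simp
  qed simp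
qed

lemma virial_deriv:
  "(virial has_real_derivative (LINT x|lborel. (\<i> * V a x) \<bullet> dil a x)) (at a)"
proof -
  let ?N = "\<lambda>t. LINT x|lborel. (v t x - v a x) \<bullet> (- (\<i> * dil a x))"
  let ?Q = "\<lambda>h. LINT x|lborel. (\<Sum>k\<in>UNIV. x $ k * ((\<i> * (v (a + h) x - v a x)) \<bullet> (d k (a + h) x - d k a x)))"
  obtain C where C: "C \<ge> 0" "\<And>h. h \<noteq> 0 \<Longrightarrow> \<bar>?Q h / h\<bar> \<le> C * \<bar>h\<bar> + \<bar>grad_gap (a + h) a / h\<bar>"
    by (rule virial_remainder_bound[of a]) blast
  have "((\<lambda>h. C * \<bar>h\<bar> + \<bar>grad_gap (a + h) a / h\<bar>) \<longlongrightarrow> C * \<bar>0\<bar> + \<bar>0\<bar>) (at 0)"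
    by (intro tendsto_intros grad_gap_little_o)
  then have lim: "((\<lambda>h. C * \<bar>h\<bar> + \<bar>grad_gap (a + h) a / h\<bar>) \<longlongrightarrow> 0) (at 0)" by simp
  have "\<forall>\<^sub>F h in at 0. norm (?Q h / h) \<le> C * \<bar>h\<bar> + \<bar>grad_gap (a + h) a / h\<bar>"
    using eventually_neq_at_within[of 0 0 UNIV] unfolding real_norm_def
    by (rule eventually_mono) (rule C(2))
  from Lim_null_comparison[OF this lim] have Q: "((\<lambda>h. ?Q h / h) \<longlongrightarrow> 0) (at 0)" .
  have "unif_bounded (\<lambda>_::real. \<lambda>x. - (\<i> * dil a x))"
    using bounded_dil unfolding unif_bounded_def by (auto simp: norm_mult)
  then have N: "(?N has_real_derivative (LINT x|lborel. V a x \<bullet> (- (\<i> * dil a x)))) (at a)"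
    by (intro v_diff_inner_deriv continuous_intros cont_dil)
  have "(virial (a + h) - virial a) / h = (?N (a + h) - ?N a) / h + ?Q h / h" for h
    by (simp add: virial_diff add_divide_distrib diff_divide_distrib)
  moreover have "((\<lambda>h. (?N (a + h) - ?N a) / h + ?Q h / h) \<longlongrightarrow> (LINT x|lborel. V a x \<bullet> (- (\<i> * dil a x))) + 0) (at 0)"
    using N unfolding DERIV_def by (intro tendsto_add Q)
  ultimately show ?thesis unfolding DERIV_def by (simp add: inner_ii_left)
qed

end

subsection \<open>The virial identity\<close>

lemma continuous_integral_eq_0D:
  fixes f :: "'a::euclidean_space \<Rightarrow> real"
  assumes "continuous_on UNIV f" "\<And>x. f x \<ge> 0" "integrable lborel f" "(LINT x|lborel. f x) = 0"
  shows "f x = 0"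
proof -
  have "AE x in lborel. f x = 0"
    using assms(2,4) integral_nonneg_eq_0_iff_AE[OF assms(3)] by simp
  moreover have op: "open {x. f x \<noteq> 0}"
    by (intro open_Collect_neq continuous_on_const assms(1))
  ultimately have "{x. f x \<noteq> 0} \<in> null_sets lborel"
    by (simp add: AE_iff_null)
  then have "negligible {x. f x \<noteq> 0}"
    by (simp add: negligible_iff_null_sets null_sets_completionI)
  then show ?thesis using open_not_negligible[OF op] by blast
qed

lemma periodic_monotone_deriv_eq_0:
  fixes f :: "real \<Rightarrow> real"
  assumes deriv: "\<And>t. (f has_real_derivative f' t) (at t)" and sign: "\<And>t. f' t \<le> 0"
    and period: "\<tau> > 0" "\<And>t. f (t + \<tau>) = f t"
  shows "f' t = 0"
proof (rule ccontr)
  assume "f' t \<noteq> 0"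
  then have "f' t < 0" using sign[of t] by simp
  from DERIV_neg_dec_right[OF deriv this] obtain e where
    e: "e > 0" "\<And>h. 0 < h \<Longrightarrow> h < e \<Longrightarrow> f (t + h) < f t" by blast
  \<comment> \<open>The point \<open>t + h\<close> lies in the range of strict decrease and not
    beyond one period, so monotonicity carries the loss on to \<open>t + \<tau>\<close>.\<close>
  define h where "h = min (e / 2) \<tau>"
  have "f (t + h) < f t" using e period by (simp add: h_def)
  moreover have "f (t + \<tau>) \<le> f (t + h)"
    by (rule DERIV_nonpos_imp_nonincreasing) (use deriv sign in \<open>auto simp: h_def\<close>)
  ultimately show False using period by simp
qed

context nls_flow
begin

text \<open>Integrating by parts in direction \<open>j\<close> leaves
  \<open>d j \<bullet> dd j k\<close>. After exchanging the mixed partials this is half the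
  \<open>k\<close>-derivative of |d j|^2, and a second integration by parts applies.\<close>

lemma integral_dd_d:
  "(LINT x|lborel. x $ k * (dd j j t x \<bullet> d k t x))
    = (LINT x|lborel. d j t x \<bullet> d j t x) / 2 - (if j = k then LINT x|lborel. d j t x \<bullet> d j t x else 0)"
proof -
  let ?jk = "\<lambda>t x. d j t x \<bullet> d k t x" and ?jj = "\<lambda>t x. d j t x \<bullet> d j t x"
  let ?a = "\<lambda>t x. x $ k * (dd j j t x \<bullet> d k t x)" and ?b = "\<lambda>t x. x $ k * (d j t x \<bullet> dd j k t x)"
  have dec: "unif_decay ?jk" "unif_decay ?jj" "unif_decay ?a" "unif_decay ?b"
    by (intro unif_decay_component_mult unif_decay_inner(1) decay_d decay_dd bounded_d
        unif_decay_imp_bounded[OF decay_dd])+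
  have int: "integrable lborel (?jk t)" "integrable lborel (?jj t)" "integrable lborel (?a t)" "integrable lborel (?b t)"
    by (rule dec[THEN integrable_unif_decay_continuous]; intro continuous_intros cont_d cont_dd)+
  have "(LINT x|lborel. (if j = k then ?jk t x else 0) + x $ k * (d j t x \<bullet> dd j k t x + dd j j t x \<bullet> d k t x)) = 0"
  proof (rule integral_partial_eq_0[where F = "\<lambda>t x. x $ k * ?jk t x" and i = j and t = t and
      F' = "\<lambda>t x. (if j = k then ?jk t x else 0) + x $ k * (d j t x \<bullet> dd j k t x + dd j j t x \<bullet> d k t x)"])
    show "has_partial j (\<lambda>x. x $ k * ?jk t x)
      (\<lambda>x. (if j = k then ?jk t x else 0) + x $ k * (d j t x \<bullet> dd j k t x + dd j j t x \<bullet> d k t x))"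
      by (intro has_partial_component_mult has_partial_inner partial2)
    show "unif_decay (\<lambda>t x. x $ k * ?jk t x)" by (intro unif_decay_component_mult dec)
    show "unif_decay (\<lambda>t x. (if j = k then ?jk t x else 0) + x $ k * (d j t x \<bullet> dd j k t x + dd j j t x \<bullet> d k t x))"
    proof -
      have "unif_decay (\<lambda>t x. if j = k then ?jk t x else 0)"
        using dec(1) by (cases "j = k") (simp_all add: unif_decay_0)
      then show ?thesis unfolding distrib_left by (intro unif_decay_add dec)
    qed
    show "(\<lambda>x. x $ k * ?jk t x) \<in> borel_measurable borel"
      by (intro borel_measurable_continuous_onI continuous_intros cont_d)
  qed
  then have 1: "(LINT x|lborel. ?a t x) = - (if j = k then LINT x|lborel. ?jj t x else 0) - (LINT x|lborel. ?b t x)"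
    using int by (cases "j = k") (simp_all add: distrib_left)
  have "(LINT x|lborel. ?jj t x + 2 * ?b t x) = 0"
  proof (rule integral_partial_eq_0[where F = "\<lambda>t x. x $ k * ?jj t x" and i = k and t = t and
      F' = "\<lambda>t x. ?jj t x + 2 * ?b t x"])
    have "has_partial k (\<lambda>x. x $ k * ?jj t x)
      (\<lambda>x. (if k = k then ?jj t x else 0) + x $ k * (d j t x \<bullet> dd k j t x + dd k j t x \<bullet> d j t x))"
      by (intro has_partial_component_mult has_partial_inner partial2)
    then show "has_partial k (\<lambda>x. x $ k * ?jj t x) (\<lambda>x. ?jj t x + 2 * ?b t x)"
      by (simp add: dd_commute[of k j] inner_commute mult.left_commute)
    show "unif_decay (\<lambda>t x. x $ k * ?jj t x)" by (intro unif_decay_component_mult dec)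
    show "unif_decay (\<lambda>t x. ?jj t x + 2 * ?b t x)" by (intro unif_decay_add unif_decay_cmult dec)
    show "(\<lambda>x. x $ k * ?jj t x) \<in> borel_measurable borel"
      by (intro borel_measurable_continuous_onI continuous_intros cont_d)
  qed
  then have "(LINT x|lborel. ?b t x) = - (LINT x|lborel. ?jj t x) / 2" using int by simp
  with 1 show ?thesis by simp
qed

text \<open>Each of the n directions \<open>k\<close> contributes half of \<open>kinetic\<close>,
  and the diagonal terms subtract it once, hence n/2 - 1.\<close>

lemma pohozaev:
  "integrable lborel (\<lambda>x. \<Sum>k\<in>UNIV. x $ k * (L t x \<bullet> d k t x))"
  "(LINT x|lborel. (\<Sum>k\<in>UNIV. x $ k * (L t x \<bullet> d k t x))) = (real CARD('n) / 2 - 1) * kinetic t"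
proof -
  have dec: "unif_decay (\<lambda>t x. x $ k * (dd j j t x \<bullet> d k t x))" for j k
    by (intro unif_decay_component_mult unif_decay_inner(1) decay_dd bounded_d)
  have int: "integrable lborel (\<lambda>x. x $ k * (dd j j t x \<bullet> d k t x))" for j k
    by (rule dec[THEN integrable_unif_decay_continuous]; intro continuous_intros cont_d cont_dd)
  have int2: "integrable lborel (\<lambda>x. d j t x \<bullet> d j t x)" for j
    by (rule integrable_unif_decay_continuous[where F = "\<lambda>t x. d j t x \<bullet> d j t x"])
      (intro unif_decay_inner(1) decay_d bounded_d continuous_intros cont_d)+
  have eq: "(\<Sum>k\<in>UNIV. x $ k * (L t x \<bullet> d k t x)) = (\<Sum>k\<in>UNIV. \<Sum>j\<in>UNIV. x $ k * (dd j j t x \<bullet> d k t x))" for x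
    by (simp add: L_def inner_sum_left sum_distrib_left)
  show "integrable lborel (\<lambda>x. \<Sum>k\<in>UNIV. x $ k * (L t x \<bullet> d k t x))"
    unfolding eq by (intro Bochner_Integration.integrable_sum int)
  let ?U = "\<lambda>j. LINT x|lborel. d j t x \<bullet> d j t x"
  have "(LINT x|lborel. (\<Sum>k\<in>UNIV. x $ k * (L t x \<bullet> d k t x)))
      = (\<Sum>k\<in>UNIV. \<Sum>j\<in>UNIV. ?U j / 2 - (if j = k then ?U j else 0))"
    unfolding eq by (simp add: int integral_dd_d)
  also have "\<dots> = real CARD('n) / 2 * (\<Sum>j\<in>UNIV. ?U j) - (\<Sum>j\<in>UNIV. ?U j)"
    by (simp add: sum_subtractf sum_divide_distrib[symmetric])
  also have "(\<Sum>j\<in>UNIV. ?U j) = kinetic t" unfolding kinetic_def by (simp add: int2)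
  finally show "(LINT x|lborel. (\<Sum>k\<in>UNIV. x $ k * (L t x \<bullet> d k t x))) = (real CARD('n) / 2 - 1) * kinetic t"
    by (simp add: algebra_simps)
qed

lemma potential_parts:
  "integrable lborel (\<lambda>x. x $ k * ((dens t x ^ m - 1) * (v t x \<bullet> d k t x)))"
  "(LINT x|lborel. x $ k * ((dens t x ^ m - 1) * (v t x \<bullet> d k t x)))
    = excess 1 t / 2 - excess (m + 1) t / (2 * real (m + 1))"
proof -
  \<comment> \<open>The primitive of (y^m - 1)/2 that vanishes at y = 1, so that
    \<open>?g (dens t x)\<close> decays where \<open>dens\<close> tends to 1.\<close>
  let ?g = "\<lambda>y. (y ^ (m + 1) - 1) / (2 * real (m + 1)) - (y - 1) / 2 :: real"
  let ?h = "\<lambda>t x. x $ k * ((dens t x ^ m - 1) * (v t x \<bullet> d k t x))"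
  have dec: "unif_decay ?h"
    by (intro unif_decay_component_mult unif_decay_mult(2) unif_decay_inner(2) decay_d bounded_v
        unif_decay_imp_bounded decay_dens_power)
  show int: "integrable lborel (?h t)"
    by (rule dec[THEN integrable_unif_decay_continuous]) (intro continuous_intros cont_d cont_v cont_dens)
  have decg: "unif_decay (\<lambda>t x. ?g (dens t x))"
    using unif_decay_diff[OF unif_decay_cmult[OF decay_dens_power[of "m + 1"], of "1 / (2 * real (m + 1))"]
      unif_decay_cmult[OF decay_dens1, of "1 / 2"]] by simp
  have intg: "integrable lborel (\<lambda>x. ?g (dens t x))"
    using integrable_excess[of t "m + 1"] integrable_excess[of t 1] by simp
  have "(LINT x|lborel. ?g (dens t x) + ?h t x) = 0"
  proof (rule integral_partial_eq_0[where F = "\<lambda>t x. x $ k * ?g (dens t x)" and i = k and t = t and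
      F' = "\<lambda>t x. ?g (dens t x) + ?h t x"])
    have g: "(?g has_real_derivative (y ^ m - 1) / 2) (at y)" for y
    proof -
      have "(?g has_real_derivative
          (real (m + 1) * y ^ (m + 1 - Suc 0) - 0) / (2 * real (m + 1)) - (1 - 0) / 2) (at y)"
        by (intro DERIV_diff DERIV_cdivide DERIV_pow DERIV_const DERIV_ident)
      then show ?thesis by (simp add: diff_divide_distrib del: of_nat_add of_nat_Suc)
    qed
    have "has_partial k (dens t) (\<lambda>x. v t x \<bullet> d k t x + d k t x \<bullet> v t x)"
      unfolding dens_def by (intro has_partial_inner partial)
    from has_partial_component_mult[OF has_partial_compose_real[OF this g], of k]
    show "has_partial k (\<lambda>x. x $ k * ?g (dens t x)) (\<lambda>x. ?g (dens t x) + ?h t x)"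
      by (simp add: inner_commute)
    show "unif_decay (\<lambda>t x. x $ k * ?g (dens t x))" by (intro unif_decay_component_mult decg)
    show "unif_decay (\<lambda>t x. ?g (dens t x) + ?h t x)" by (intro unif_decay_add decg dec)
    show "(\<lambda>x. x $ k * ?g (dens t x)) \<in> borel_measurable borel"
      by (intro borel_measurable_continuous_onI continuous_intros cont_dens) simp_all
  qed
  then have "(LINT x|lborel. ?h t x) = - (LINT x|lborel. ?g (dens t x))"
    by (simp only: Bochner_Integration.integral_add[OF intg int])
  also have "(LINT x|lborel. ?g (dens t x)) = excess (m + 1) t / (2 * real (m + 1)) - excess 1 t / 2"
    using integrable_excess[of t "m + 1"] integrable_excess[of t 1] by (simp add: excess_def)
  finally show "(LINT x|lborel. ?h t x) = excess 1 t / 2 - excess (m + 1) t / (2 * real (m + 1))" by simp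
qed

text \<open>The coefficients of \<open>kinetic\<close> are -(n - 2) from Pohozaev and n from Green's
  formula, together 2. The two contributions of \<open>excess 1\<close> cancel, and those of
  \<open>excess (m + 1)\<close> combine by 1 - 1/(m + 1) = m/(m + 1).\<close>

lemma virial_identity:
  "(LINT x|lborel. (\<i> * V t x) \<bullet> dil t x)
    = 2 * kinetic t + real CARD('n) * \<epsilon> * (real m / real (m + 1)) * excess (m + 1) t"
proof -
  let ?n = "real CARD('n)"
  let ?f = "\<lambda>x. dens t x ^ m - 1"
  let ?p = "\<lambda>x. \<Sum>k\<in>UNIV. x $ k * (?f x * (v t x \<bullet> d k t x))"
  let ?q = "\<lambda>x. \<Sum>k\<in>UNIV. x $ k * (L t x \<bullet> d k t x)"
  let ?r = "\<lambda>x. (dens t x ^ (m + 1) - 1) - (dens t x ^ 1 - 1)"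
  have "(\<i> * V t x) \<bullet> dil t x
      = 2 * \<epsilon> * ?p x + ?n * \<epsilon> * ?r x - 2 * ?q x - ?n * (v t x \<bullet> L t x)" for x
  proof -
    have W: "(\<i> * V t x) \<bullet> w = \<epsilon> * ?f x * (v t x \<bullet> w) - L t x \<bullet> w" for w
      unfolding i_V scaleR_conv_of_real[symmetric] by (simp only: inner_diff_left inner_scaleR_left)
    have "(\<i> * V t x) \<bullet> dil t x
        = (\<Sum>k\<in>UNIV. 2 * (x $ k * ((\<i> * V t x) \<bullet> d k t x))) + ?n * ((\<i> * V t x) \<bullet> v t x)"
      by (simp only: dil_def inner_add_right inner_sum_right inner_scaleR_right)
    also have "(\<Sum>k\<in>UNIV. 2 * (x $ k * ((\<i> * V t x) \<bullet> d k t x))) = 2 * \<epsilon> * ?p x - 2 * ?q x"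
      unfolding sum_distrib_left sum_subtractf[symmetric]
      by (intro sum.cong refl) (simp add: W algebra_simps)
    also have "?n * ((\<i> * V t x) \<bullet> v t x) = ?n * \<epsilon> * ?r x - ?n * (v t x \<bullet> L t x)"
      by (simp add: W dens_def[symmetric] inner_commute[of "L t x"] algebra_simps)
    finally show ?thesis by simp
  qed
  then have "(LINT x|lborel. (\<i> * V t x) \<bullet> dil t x)
      = (LINT x|lborel. 2 * \<epsilon> * ?p x + ?n * \<epsilon> * ?r x - 2 * ?q x - ?n * (v t x \<bullet> L t x))"
    by (simp only:)
  also have "\<dots> = 2 * \<epsilon> * (LINT x|lborel. ?p x) + ?n * \<epsilon> * (LINT x|lborel. ?r x)
      - 2 * (LINT x|lborel. ?q x) - ?n * (LINT x|lborel. v t x \<bullet> L t x)"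
  proof -
    have "integrable lborel ?p" by (intro Bochner_Integration.integrable_sum potential_parts)
    moreover have "integrable lborel ?r" by (intro Bochner_Integration.integrable_diff integrable_excess)
    moreover have "integrable lborel (\<lambda>x. v t x \<bullet> L t x)"
      by (rule integrable_unif_decay_continuous[where F = "\<lambda>t x. v t x \<bullet> L t x"])
        (intro unif_decay_inner(2) decay_L bounded_v continuous_intros cont_v cont_L)+
    moreover have "(LINT x|lborel. A * p x + B * r x - 2 * q x - N * s x) = A * (LINT x|lborel. p x)
        + B * (LINT x|lborel. r x) - 2 * (LINT x|lborel. q x) - N * (LINT x|lborel. s x)"
      if "integrable lborel p" "integrable lborel r" "integrable lborel q" "integrable lborel s"
      for A B N :: real and p q r s :: "real^'n \<Rightarrow> real"
      using that by simp
    ultimately show ?thesis using pohozaev(1) by blast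
  qed
  also have "(LINT x|lborel. ?p x) = ?n * (excess 1 t / 2 - excess (m + 1) t / (2 * real (m + 1)))"
    by (simp add: potential_parts del: of_nat_Suc)
  also have "(LINT x|lborel. ?r x) = excess (m + 1) t - excess 1 t"
    unfolding excess_def by (intro Bochner_Integration.integral_diff integrable_excess)
  finally show ?thesis unfolding pohozaev(2) green_self
    by (simp add: field_simps)
qed

lemma rest_of_kinetic_eq_0:
  assumes "kinetic t = 0"
  shows "v t x = 1"
proof -
  have "(\<Sum>k\<in>UNIV. d k t y \<bullet> d k t y) = 0" for y
    by (rule continuous_integral_eq_0D[OF _ _ integrable_kinetic])
      (use assms in \<open>auto simp: kinetic_def intro!: continuous_intros cont_d sum_nonneg\<close>)
  then have d0: "d k t y = 0" for k y
    by (simp add: sum_nonneg_eq_0_iff)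
  \<comment> \<open>One coordinate direction is enough: \<open>v t\<close> is constant along that
    line and tends to 1 at its end.\<close>
  obtain k :: 'n where True by blast
  have const: "v t (x + s *\<^sub>R axis k 1) = v t x" for s
  proof -
    have "((\<lambda>s. v t (x + s *\<^sub>R axis k 1)) has_vector_derivative 0) (at r within UNIV)" for r
      using has_partial_line[OF partial[of k t], of x r] by (simp add: d0)
    then obtain c where c: "\<And>s. s \<in> UNIV \<Longrightarrow> v t (x + s *\<^sub>R axis k 1) = c"
      by (rule has_vector_derivative_zero_constant[OF convex_UNIV]) blast
    show ?thesis using c[of s] c[of 0] by simp
  qed
  obtain C c where C: "C \<ge> 0" "c > 0" "\<And>t x. norm (v t x - 1) \<le> C * exp (- c * norm x)"
    using unif_decayE[OF decay_v] by blast
  have bound: "norm (v t x - 1) \<le> C * exp (c * norm x) * exp (- c * s)" if "s \<ge> 0" for s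
  proof -
    have "s \<le> norm (x + s *\<^sub>R axis k 1) + norm x"
      using norm_triangle_ineq4[of "x + s *\<^sub>R axis k 1" x] that by simp
    then have "c * s \<le> c * (norm (x + s *\<^sub>R axis k 1) + norm x)" using C(2) by simp
    then have "C * exp (- c * norm (x + s *\<^sub>R axis k 1)) \<le> C * exp (c * norm x + - c * s)"
      using C(1) by (intro mult_left_mono) (simp_all add: algebra_simps)
    then show ?thesis using C(3)[of t "x + s *\<^sub>R axis k 1"] unfolding const exp_add by (simp add: mult.assoc)
  qed
  have "((\<lambda>s. exp (- c * s)) \<longlongrightarrow> 0) at_top"
    using C(2) by (intro filterlim_compose[OF exp_at_bot] filterlim_tendsto_neg_mult_at_bot[OF tendsto_const])
      (auto simp: filterlim_ident)
  then have "((\<lambda>s. C * exp (c * norm x) * exp (- c * s)) \<longlongrightarrow> C * exp (c * norm x) * 0) at_top"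
    by (intro tendsto_mult tendsto_const)
  then have "norm (v t x - 1) \<le> C * exp (c * norm x) * 0"
    by (rule tendsto_lowerbound) (rule eventually_mono[OF eventually_ge_at_top[of 0] bound], simp_all)
  then show ?thesis by simp
qed

end

subsection \<open>Breathers\<close>

lemma has_partial_partial_deriv:
  fixes f :: "real^'n::finite \<Rightarrow> 'b::real_normed_vector"
  assumes "f differentiable_on UNIV"
  shows "has_partial i f (partial_deriv i f)"
  unfolding has_partial_def partial_deriv_def vector_derivative_works[symmetric]
proof
  fix x
  have "f differentiable at (x + 0 *\<^sub>R axis i 1)" using assms by (simp add: differentiable_on_def)
  moreover have "(\<lambda>h. x + h *\<^sub>R axis i (1::real)) differentiable at 0"
    by (intro differentiable_add differentiable_scaleR differentiable_const differentiable_ident)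
  ultimately show "(\<lambda>h. f (x + h *\<^sub>R axis i 1)) differentiable at 0"
    using differentiable_chain_at[of "\<lambda>h. x + h *\<^sub>R axis i (1::real)" 0 f] by (simp add: o_def)
qed

lemma has_partial_unique: "has_partial i f f' \<Longrightarrow> partial_deriv i f = f'"
  unfolding has_partial_def partial_deriv_def by (auto intro: vector_derivative_at)

context nls_flow
begin

lemma partial_deriv_v: "partial_deriv k (v t) = d k t"
  by (rule has_partial_unique[OF partial])

lemma excess_1_eq: "excess 1 s = excess 1 t"
  using DERIV_isconst_all[of "excess 1"] excess_1_const by blast

lemma energy_eq: "energy s = energy t"
  using DERIV_isconst_all[of energy] energy_const by blast

text \<open>The mass and energy integrate over \<open>lebesgue\<close>, the locale over
  \<open>lborel\<close>; for Borel integrands the two integrals agree.\<close>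

lemma M_nz_eq: "M_nz (v t) = excess 1 t"
  unfolding M_nz_def excess_def
  by (subst integral_completion)
    (auto simp: dens_cmod intro!: borel_measurable_continuous_onI continuous_intros cont_v)

lemma E_nz_eq: "E_nz \<epsilon> (2 * m) (v t) = energy t"
proof -
  have e: "(\<Sum>k\<in>UNIV. (cmod (partial_deriv k (v t) x))\<^sup>2) - 2 * \<epsilon> / (real (2 * m) + 2) * (1 - cmod (v t x) ^ (2 * m + 2))
      = (\<Sum>k\<in>UNIV. d k t x \<bullet> d k t x) + \<epsilon> / real (m + 1) * (dens t x ^ (m + 1) - 1)" for x
  proof -
    have "2 * \<epsilon> / (real (2 * m) + 2) = \<epsilon> / real (m + 1)" by (simp add: field_simps)
    moreover have "cmod (v t x) ^ (2 * m + 2) = dens t x ^ (m + 1)"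
      unfolding dens_cmod power_mult[symmetric] by simp
    ultimately show ?thesis
      by (simp add: partial_deriv_v power2_norm_eq_inner right_diff_distrib)
  qed
  have "E_nz \<epsilon> (2 * m) (v t)
      = (LINT x|lborel. (\<Sum>k\<in>UNIV. d k t x \<bullet> d k t x) + \<epsilon> / real (m + 1) * (dens t x ^ (m + 1) - 1))"
    unfolding E_nz_def e
    by (intro integral_completion)
      (unfold measurable_lborel2, intro borel_measurable_continuous_onI continuous_intros cont_d cont_dens,
        simp del: of_nat_add)
  also have "\<dots> = energy t"
    unfolding energy_def kinetic_def excess_def
    by (simp only: integral_mult_right_zero
        Bochner_Integration.integral_add[OF integrable_kinetic integrable_mult_right[OF integrable_excess]])
  finally show ?thesis .
qed

lemma virial_period: "v s = v t \<Longrightarrow> virial s = virial t"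
  unfolding virial_def partial_deriv_v[symmetric] by simp

lemma virial_deriv_energy:
  "(virial has_real_derivative
    2 * kinetic t + real CARD('n) * \<epsilon> * (real m / real (m + 1)) * excess (m + 1) t) (at t)"
  using virial_deriv[of t] unfolding virial_identity .

text \<open>The condition covers the cubic plane and the quintic line at once. The virial functional
  is periodic with constant slope, so the slope is 0.\<close>

lemma energy_eq_0_of_periodic:
  assumes "\<tau> > 0" "\<And>t. v (t + \<tau>) = v t" "m * CARD('n) = 2"
  shows "energy t = 0"
proof -
  have mn: "real CARD('n) * real m = 2" using assms(3) by (metis mult.commute of_nat_mult of_nat_numeral)
  have "2 * kinetic s + real CARD('n) * \<epsilon> * (real m / real (m + 1)) * excess (m + 1) s = 2 * energy t" for s
  proof -
    have eq: "real CARD('n) * \<epsilon> * (real m / real (m + 1)) = (real CARD('n) * real m) * (\<epsilon> / real (m + 1))" by simp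
    show ?thesis unfolding eq mn energy_eq[of t s] unfolding energy_def by (simp add: algebra_simps)
  qed
  then have "(virial has_real_derivative 2 * energy t) (at s)" for s
    using virial_deriv_energy[of s] by simp
  then obtain z where "virial (0 + \<tau>) - virial 0 = (0 + \<tau> - 0) * (2 * energy t)"
    using MVT2[of 0 "0 + \<tau>" virial "\<lambda>_. 2 * energy t"] assms(1) by auto
  then show ?thesis using virial_period[OF assms(2), of 0] assms(1) by simp
qed

text \<open>The virial derivative splits into a conserved quantity of the sign assumed and a defect which
  vanishes only where the modulus is \<open>1\<close>; a periodic function cannot be strictly monotone.\<close>

lemma trivial_of_periodic:
  fixes W :: "real \<Rightarrow> real"
  assumes "\<tau> > 0" "\<And>t. v (t + \<tau>) = v t"
    and W: "\<And>y. y \<ge> 0 \<Longrightarrow> W y \<ge> 0" "continuous_on UNIV W" "\<And>y. y \<ge> 0 \<Longrightarrow> W y = 0 \<Longrightarrow> y = 1"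
    and int: "\<And>t. integrable lborel (\<lambda>x. W (dens t x))"
    and Q: "Q \<le> 0" and \<sigma>: "\<sigma> \<noteq> 0"
    and split: "\<And>t. \<sigma> * (2 * kinetic t + real CARD('n) * \<epsilon> * (real m / real (m + 1)) * excess (m + 1) t)
      = Q - (LINT x|lborel. W (dens t x))"
  shows "v t x = 1"
proof -
  have dens0: "dens t x \<ge> 0" for t x by (simp add: dens_def)
  have Wi: "(LINT x|lborel. W (dens t x)) \<ge> 0" for t
    by (intro Bochner_Integration.integral_nonneg W dens0)
  have D: "((\<lambda>t. \<sigma> * virial t) has_real_derivative Q - (LINT x|lborel. W (dens t x))) (at t)" for t
    unfolding split[symmetric] by (intro DERIV_cmult virial_deriv_energy)
  have "Q - (LINT x|lborel. W (dens t x)) = 0" for t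
    by (rule periodic_monotone_deriv_eq_0[OF D _ assms(1)])
      (use Q Wi in \<open>auto simp: virial_period[OF assms(2)] intro: order_trans\<close>)
  note eq0 = this
  \<comment> \<open>A nonpositive \<open>Q\<close> equals a nonnegative integral, so both
    vanish.\<close>
  have "(LINT x|lborel. W (dens t x)) = 0" using eq0[of t] Q Wi[of t] by linarith
  then have "W (dens t y) = 0" for y
    by (intro continuous_integral_eq_0D[OF _ _ int] W dens0 continuous_on_compose2[OF W(2)] cont_dens) simp_all
  then have "dens t y = 1" for y using W(3) dens0 by blast
  \<comment> \<open>Modulus 1 alone still allows a varying phase. With no potential term left,
    \<open>split\<close> forces the kinetic part to vanish as well.\<close>
  then have "excess (m + 1) t = 0" by (simp add: excess_def)
  then have "kinetic t = 0" using split[of t] eq0[of t] \<sigma> by simp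
  then show ?thesis by (rule rest_of_kinetic_eq_0)
qed

lemma cubic_line_trivial:
  assumes "\<tau> > 0" "\<And>t. v (t + \<tau>) = v t" and "m = 1" "CARD('n) = 1" "\<epsilon> * \<epsilon> = 1"
    and "\<epsilon> * (energy s - \<epsilon> / 2 * excess 1 s) \<le> 0"
  shows "v t x = 1"
proof -
  \<comment> \<open>Here \<epsilon> J' is 2 \<epsilon> E minus half of \<open>excess 2\<close>;
    removing the tangent line of y^2/2 at 1 by means of the mass completes the square.\<close>
  let ?W = "\<lambda>y::real. (y - 1)\<^sup>2 / 2"
  have W: "?W y = 1 / 2 * (y ^ 2 - 1) - (y ^ 1 - 1)" for y
    by (simp add: power2_eq_square field_simps)
  have int: "integrable lborel (\<lambda>x. ?W (dens t x))" for t
    unfolding W by (intro Bochner_Integration.integrable_diff integrable_mult_right integrable_excess)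
  have iW: "(LINT x|lborel. ?W (dens t x)) = 1 / 2 * excess 2 t - excess 1 t" for t
    by (simp only: W excess_def integral_mult_right_zero
        Bochner_Integration.integral_diff[OF integrable_mult_right[OF integrable_excess] integrable_excess])
  show ?thesis
  proof (rule trivial_of_periodic[where W = ?W and \<sigma> = \<epsilon> and
      Q = "2 * (\<epsilon> * (energy s - \<epsilon> / 2 * excess 1 s))"])
    show "\<epsilon> * (2 * kinetic t + real CARD('n) * \<epsilon> * (real m / real (m + 1)) * excess (m + 1) t)
      = 2 * (\<epsilon> * (energy s - \<epsilon> / 2 * excess 1 s)) - (LINT x|lborel. ?W (dens t x))" for t
    proof -
      have ee: "\<epsilon> * (\<epsilon> * z) = z" for z using assms(5) by (simp add: mult.assoc[symmetric])
      show ?thesis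
        unfolding energy_eq[of s t] excess_1_eq[of s t] iW unfolding energy_def using assms(3,4)
        by (simp add: algebra_simps ee numeral_2_eq_2[symmetric])
    qed
  qed (use assms int in \<open>auto intro!: continuous_intros\<close>)
qed

lemma quintic_plane_trivial:
  assumes "\<tau> > 0" "\<And>t. v (t + \<tau>) = v t" and "m = 2" "CARD('n) = 2" "\<epsilon> * \<epsilon> = 1"
    and "\<epsilon> * (energy s + \<epsilon> * excess 1 s) \<ge> 0"
  shows "v t x = 1"
proof -
  \<comment> \<open>Two thirds of y^3 - 3y + 2, the cubic minus its tangent line at 1. The other
    root -2 lies outside the range of |v|^2.\<close>
  let ?W = "\<lambda>y::real. 2 / 3 * ((y - 1)\<^sup>2 * (y + 2))"
  have W: "?W y = 2 / 3 * (y ^ 3 - 1) - 2 * (y ^ 1 - 1)" for y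
    by (simp add: power2_eq_square power3_eq_cube field_simps)
  have int: "integrable lborel (\<lambda>x. ?W (dens t x))" for t
    unfolding W by (intro Bochner_Integration.integrable_diff integrable_mult_right integrable_excess)
  have iW: "(LINT x|lborel. ?W (dens t x)) = 2 / 3 * excess 3 t - 2 * excess 1 t" for t
    by (simp only: W excess_def integral_mult_right_zero Bochner_Integration.integral_diff[OF
        integrable_mult_right[OF integrable_excess] integrable_mult_right[OF integrable_excess]])
  show ?thesis
  \<comment> \<open>Here n m - 2 is positive, so the sign of \<epsilon> is reversed compared with
    the cubic line.\<close>
  proof (rule trivial_of_periodic[where W = ?W and \<sigma> = "- \<epsilon>" and
      Q = "- 2 * (\<epsilon> * (energy s + \<epsilon> * excess 1 s))"])
    show "- \<epsilon> * (2 * kinetic t + real CARD('n) * \<epsilon> * (real m / real (m + 1)) * excess (m + 1) t)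
      = - 2 * (\<epsilon> * (energy s + \<epsilon> * excess 1 s)) - (LINT x|lborel. ?W (dens t x))" for t
    proof -
      have ee: "\<epsilon> * (\<epsilon> * z) = z" for z using assms(5) by (simp add: mult.assoc[symmetric])
      show ?thesis
        unfolding energy_eq[of s t] excess_1_eq[of s t] iW unfolding energy_def using assms(3,4)
        by (simp add: algebra_simps ee numeral_3_eq_3)
    qed
  qed (use assms int in \<open>auto intro!: continuous_intros\<close>)
qed

end

lemma nls_flow_breather:
  fixes v :: "real \<Rightarrow> real^'n::finite \<Rightarrow> complex"
  assumes "breather \<epsilon> (2 * m) v"
  shows "nls_flow v (\<lambda>t x. vector_derivative (\<lambda>s. v s x) (at t)) (\<lambda>k t. partial_deriv k (v t))
    (\<lambda>j k t. partial_deriv j (partial_deriv k (v t))) \<epsilon> m"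
proof -
  have sol: "nls_solution \<epsilon> (2 * m) v" using assms unfolding breather_def by blast
  obtain C \<gamma> where sm: "\<And>t. smooth (v t)" and "\<gamma> > 0"
    and bd: "\<And>is t x. length is \<le> 2 \<Longrightarrow>
      cmod (iterated_partial is (\<lambda>y. v t y - 1) x) \<le> C * exp (- \<gamma> * norm x)"
    using assms unfolding breather_def by metis
  have diff: "iterated_partial is (v t) differentiable_on UNIV" for "is" t
    using sm unfolding smooth_def by blast
  have diff0: "v t differentiable_on UNIV" for t
    using diff[of "[]" t] by (simp add: iterated_partial_def)
  have diff1: "partial_deriv k (v t) differentiable_on UNIV" for k t
    using diff[of "[k]" t] by (simp add: iterated_partial_def)
  have diff2: "partial_deriv j (partial_deriv k (v t)) differentiable_on UNIV" for j k t
    using diff[of "[j, k]" t] by (simp add: iterated_partial_def)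
  \<comment> \<open>The decay is given for derivatives of \<open>v - 1\<close>, while the flow uses
    those of \<open>v\<close>; from first order on they coincide.\<close>
  have shift: "partial_deriv k (\<lambda>y. v t y - 1) = partial_deriv k (v t)" for k t
  proof (rule has_partial_unique)
    have "has_partial k (\<lambda>_. 1 :: complex) (\<lambda>_. 0)" unfolding has_partial_def by simp
    from has_partial_diff[OF has_partial_partial_deriv[OF diff0] this]
    show "has_partial k (\<lambda>y. v t y - 1) (partial_deriv k (v t))" by simp
  qed
  have dec: "unif_decay F" if "\<And>t x. cmod (F t x) \<le> C * exp (- \<gamma> * norm x)"
    for F :: "real \<Rightarrow> real^'n \<Rightarrow> complex"
    using that \<open>\<gamma> > 0\<close> unfolding unif_decay_def by blast
  show ?thesis
  proof
    show "unif_decay (\<lambda>t x. v t x - 1)"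
      using bd[of "[]"] by (intro dec) (simp add: iterated_partial_def)
    show "unif_decay (\<lambda>t. partial_deriv k (v t))" for k
      using bd[of "[k]"] by (intro dec) (simp add: iterated_partial_def shift)
    show "unif_decay (\<lambda>t. partial_deriv j (partial_deriv k (v t)))" for j k
      using bd[of "[j, k]"] by (intro dec) (simp add: iterated_partial_def shift)
    show "((\<lambda>s. v s x) has_vector_derivative vector_derivative (\<lambda>s. v s x) (at t)) (at t)" for x t
      using sol unfolding nls_solution_def vector_derivative_works by blast
    show "\<i> * vector_derivative (\<lambda>s. v s x) (at t) + (\<Sum>k\<in>UNIV. partial_deriv k (partial_deriv k (v t)) x)
      = complex_of_real (\<epsilon> * (cmod (v t x) ^ (2 * m) - 1)) * v t x" for x t
      using sol unfolding nls_solution_def laplacian_def by blast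
  qed (intro has_partial_partial_deriv differentiable_imp_continuous_on diff0 diff1 diff2)+
qed

theorem theorem3p2:
  fixes \<epsilon> :: real and p :: nat
  assumes "\<epsilon> \<in> {1, -1}"
  shows "\<not> (\<exists>(v :: real \<Rightarrow> real^'n::finite \<Rightarrow> complex) t.
    breather \<epsilon> p v \<and>
    ((p = 2 \<and> CARD('n) = 1 \<and> \<epsilon> * (E_nz \<epsilon> p (v t) - \<epsilon> / 2 * M_nz (v t)) \<le> 0) \<or>
     (p = 2 \<and> CARD('n) = 2 \<and> E_nz \<epsilon> p (v t) \<noteq> 0) \<or>
     (p = 4 \<and> CARD('n) = 1 \<and> E_nz \<epsilon> p (v t) \<noteq> 0) \<or>
     (p = 4 \<and> CARD('n) = 2 \<and> \<epsilon> * (E_nz \<epsilon> p (v t) + \<epsilon> * M_nz (v t)) \<ge> 0)))"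
proof (intro notI, elim exE conjE)
  fix v :: "real \<Rightarrow> real^'n \<Rightarrow> complex" and t
  assume br: "breather \<epsilon> p v"
    and cases: "(p = 2 \<and> CARD('n) = 1 \<and> \<epsilon> * (E_nz \<epsilon> p (v t) - \<epsilon> / 2 * M_nz (v t)) \<le> 0) \<or>
     (p = 2 \<and> CARD('n) = 2 \<and> E_nz \<epsilon> p (v t) \<noteq> 0) \<or>
     (p = 4 \<and> CARD('n) = 1 \<and> E_nz \<epsilon> p (v t) \<noteq> 0) \<or>
     (p = 4 \<and> CARD('n) = 2 \<and> \<epsilon> * (E_nz \<epsilon> p (v t) + \<epsilon> * M_nz (v t)) \<ge> 0)"
  define m where "m = p div 2"
  have p: "p = 2 * m" using cases by (auto simp: m_def)
  interpret nls_flow v "\<lambda>t x. vector_derivative (\<lambda>s. v s x) (at t)" "\<lambda>k t. partial_deriv k (v t)"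
    "\<lambda>j k t. partial_deriv j (partial_deriv k (v t))" \<epsilon> m
    using br unfolding p by (rule nls_flow_breather)
  obtain \<tau> where \<tau>: "\<tau> > 0" "\<And>t. v (t + \<tau>) = v t"
    using br unfolding breather_def by (metis ext)
  have nontrivial: "\<exists>t x. v t x \<noteq> 1" using br unfolding breather_def by blast
  have ee: "\<epsilon> * \<epsilon> = 1" using assms by auto
  \<comment> \<open>Four regimes become three cases, since both conditions
    \<open>E_nz \<noteq> 0\<close> have \<open>m * CARD('n) = 2\<close>.\<close>
  consider "m = 1" "CARD('n) = 1" "\<epsilon> * (energy t - \<epsilon> / 2 * excess 1 t) \<le> 0"
    | "m * CARD('n) = 2" "energy t \<noteq> 0"
    | "m = 2" "CARD('n) = 2" "\<epsilon> * (energy t + \<epsilon> * excess 1 t) \<ge> 0"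
    using cases unfolding p E_nz_eq M_nz_eq by fastforce
  then show False
  proof cases
    case 1
    then show ?thesis using cubic_line_trivial[OF \<tau> 1(1,2) ee 1(3)] nontrivial by blast
  next
    case 2
    then show ?thesis using energy_eq_0_of_periodic[OF \<tau> 2(1)] by blast
  next
    case 3
    then show ?thesis using quintic_plane_trivial[OF \<tau> 3(1,2) ee 3(3)] nontrivial by blast
  qed
qed

end
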